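(* Let $\mathbb{F}$ be a field, let $V=\mathbb{F}^2\otimes\mathbb{F}^2\otimes\mathbb{F}^2$ (so that $\mathrm{PG}(V)=\mathrm{PG}(7,\mathbb{F})$), let $X\subset \mathrm{PG}(V)$ be the set of $\mathbb{F}$-rational points of the Segre variety $S_{2,2,2}(\mathbb{F})$, and let $G_X$ be the setwise stabiliser of $X$ in $\mathrm{PGL}(V)$. (i) If $\mathbb{F}$ is algebraically closed, then $G_X$ has exactly four orbits on the points of $\mathrm{PG}(V)$. (ii) If $\mathbb{F}$ is finite, then $G_X$ has exactly five orbits on the points of $\mathrm{PG}(V)$.
   Context: Tensor products are over $\mathbb{F}$. For a vector space $V$, $\mathrm{PG}(V)$ denotes the projective space whose points are the one-dimensional subspaces $\langle v\rangle$ of $V$ ($v\neq 0$), and $\mathrm{PGL}(V)$ denotes the projective general linear group acting on it. The set $X$ of $\mathbb{F}$-rational points of the Segre variety $S_{2,2,2}(\mathbb{F})$ (product of three projective lines) is the image of the Segre embedding $\mathrm{PG}(V_1)\times\mathrm{PG}(V_2)\times\mathrm{PG}(V_3)\to \mathrm{PG}(V)$, $(\langle v_1\rangle,\langle v_2\rangle,\langle v_3\rangle)\mapsto\langle v_1\otimes v_2\otimes v_3\rangle$, where $V_1=V_2=V_3=\mathbb{F}^2$ and $V=V_1\otimes V_2\otimes V_3$. *)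

theory Defs
  imports "HOL-Analysis.Analysis" "HOL-Algebra.Group_Action"
    "HOL-Computational_Algebra.Polynomial"
begin

definition PG :: "('a::field ^ 'n) set set" where
  "PG = {vec.span {v} | v. v \<noteq> 0}"

definition GL :: "('a::field ^ 'n \<Rightarrow> 'a ^ 'n) monoid" where
  "GL = \<lparr>carrier = {f. Vector_Spaces.linear (*s) (*s) f \<and> bij f}, mult = (\<circ>), one = id\<rparr>"

definition scalars :: "('a::field ^ 'n \<Rightarrow> 'a ^ 'n) set" where
  "scalars = {(*s) c | c. c \<noteq> 0}"

definition PGL :: "('a::field ^ 'n \<Rightarrow> 'a ^ 'n) set monoid" where
  "PGL = GL Mod scalars"

text \<open>
  An element of \<open>PGL\<close> is a coset of linear automorphisms, all of which send a given point
  to the same image (see \<open>PGL_act_coset\<close> below), so the union over the coset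
  is just that common image.
\<close>

definition PGL_act :: "('a::field ^ 'n \<Rightarrow> 'a ^ 'n) set \<Rightarrow> ('a ^ 'n) set \<Rightarrow> ('a ^ 'n) set" where
  "PGL_act C = (\<lambda>P\<in>PG. \<Union>f\<in>C. f ` P)"

text \<open>
  The tensor product of three copies of the plane is modelled by coordinate arrays with
  index set \<open>2 \<times> 2 \<times> 2\<close>; the lemma \<open>tensor3_universal\<close>
  below confirms that this, with \<open>tensor3\<close>, has the universal property.
\<close>

type_synonym 'a tensor222 = "('a, 2 \<times> 2 \<times> 2) vec"

definition tensor3 :: "'a::field ^ 2 \<Rightarrow> 'a ^ 2 \<Rightarrow> 'a ^ 2 \<Rightarrow> 'a tensor222" where
  "tensor3 u v w = (\<chi> p. case p of (i, j, k) \<Rightarrow> u $ i * v $ j * w $ k)"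

definition segre_points :: "'a::field tensor222 set set" where
  "segre_points = {vec.span {tensor3 u v w} | u v w. u \<noteq> 0 \<and> v \<noteq> 0 \<and> w \<noteq> 0}"

definition segre_stabilizer :: "('a::field tensor222 \<Rightarrow> 'a tensor222) set monoid" where
  "segre_stabilizer = PGL\<lparr>carrier := stabilizer PGL (\<lambda>g. (`) (PGL_act g)) segre_points\<rparr>"

lemma group_GL: "group (GL :: ('a::field ^ 'n \<Rightarrow> 'a ^ 'n) monoid)"
proof (rule groupI)
  fix f :: "'a ^ 'n \<Rightarrow> 'a ^ 'n" assume "f \<in> carrier GL"
  then have f: "Vector_Spaces.linear (*s) (*s) f" "bij f" by (auto simp: GL_def)
  have "Vector_Spaces.linear (*s) (*s) (inv_into UNIV f)"
  proof -
    interpret f: Vector_Spaces.linear "(*s)" "(*s)" f by fact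
    have fi: "f (inv_into UNIV f x) = x" "inv_into UNIV f (f x) = x" for x
      using f(2) by (simp_all add: bij_is_surj surj_f_inv_f bij_is_inj)
    show ?thesis
    proof unfold_locales
      show "inv_into UNIV f (x + y) = inv_into UNIV f x + inv_into UNIV f y" for x y
        using fi(2)[of "inv_into UNIV f x + inv_into UNIV f y"] by (simp add: f.add fi(1))
      show "inv_into UNIV f (c *s x) = c *s inv_into UNIV f x" for c x
        using fi(2)[of "c *s inv_into UNIV f x"] by (simp add: f.scale fi(1))
    qed
  qed
  then show "\<exists>g\<in>carrier GL. g \<otimes>\<^bsub>GL\<^esub> f = \<one>\<^bsub>GL\<^esub>"
    using f by (intro bexI[of _ "inv_into UNIV f"])
      (auto simp: GL_def bij_imp_bij_inv bij_is_inj)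
qed (auto simp: GL_def vec.linear_id intro: Vector_Spaces.linear_compose bij_comp)

lemma scalars_subset_GL: "scalars \<subseteq> carrier GL"
proof
  fix f :: "'a ^ 'n \<Rightarrow> 'a ^ 'n" assume "f \<in> scalars"
  then obtain c where c: "c \<noteq> 0" "f = (*s) c" by (auto simp: scalars_def)
  have "bij f"
    by (rule o_bij[of "(*s) (inverse c)"]) (use c in \<open>auto simp: fun_eq_iff\<close>)
  moreover have "Vector_Spaces.linear (*s) (*s) f"
    unfolding c by (rule vec.linear_scale_self)
  ultimately show "f \<in> carrier GL" by (simp add: GL_def)
qed

lemma normal_scalars_GL: "scalars \<lhd> (GL :: ('a::field ^ 'n \<Rightarrow> 'a ^ 'n) monoid)"
proof -
  interpret group "GL :: ('a ^ 'n \<Rightarrow> 'a ^ 'n) monoid" by (rule group_GL)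
  have comm: "f \<circ> s = s \<circ> f" if "f \<in> carrier GL" "s \<in> scalars" for f s :: "'a ^ 'n \<Rightarrow> 'a ^ 'n"
  proof -
    interpret f: Vector_Spaces.linear "(*s)" "(*s)" f using that by (simp add: GL_def)
    show ?thesis using that by (auto simp: scalars_def fun_eq_iff f.scale)
  qed
  have sub: "subgroup scalars (GL :: ('a ^ 'n \<Rightarrow> 'a ^ 'n) monoid)"
  proof (rule subgroupI)
    show "scalars \<subseteq> carrier (GL :: ('a ^ 'n \<Rightarrow> 'a ^ 'n) monoid)" by (rule scalars_subset_GL)
    show "(scalars :: ('a ^ 'n \<Rightarrow> 'a ^ 'n) set) \<noteq> {}" by (auto simp: scalars_def intro: exI[of _ 1])
  next
    fix s :: "'a ^ 'n \<Rightarrow> 'a ^ 'n" assume s: "s \<in> scalars"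
    then obtain c where c: "c \<noteq> 0" "s = (*s) c" by (auto simp: scalars_def)
    have i: "(*s) (inverse c) \<in> (scalars :: ('a ^ 'n \<Rightarrow> 'a ^ 'n) set)"
      using c(1) nonzero_imp_inverse_nonzero unfolding scalars_def by blast
    have "inv\<^bsub>GL\<^esub> s = (*s) (inverse c)"
    proof (rule inv_equality)
      show "(*s) (inverse c) \<otimes>\<^bsub>GL\<^esub> s = \<one>\<^bsub>GL\<^esub>"
        using c by (auto simp: GL_def fun_eq_iff)
    qed (use s i scalars_subset_GL in blast)+
    then show "inv\<^bsub>GL\<^esub> s \<in> scalars" using i by simp
  next
    fix s t :: "'a ^ 'n \<Rightarrow> 'a ^ 'n" assume "s \<in> scalars" "t \<in> scalars"
    then obtain c d where "c \<noteq> 0" "s = (*s) c" "d \<noteq> 0" "t = (*s) d"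
      by (auto simp: scalars_def)
    then show "s \<otimes>\<^bsub>GL\<^esub> t \<in> scalars"
      by (auto simp: GL_def scalars_def fun_eq_iff intro!: exI[of _ "c * d"])
  qed
  show ?thesis
  proof (rule normalI[OF sub], rule ballI)
    fix x :: "'a ^ 'n \<Rightarrow> 'a ^ 'n" assume "x \<in> carrier GL"
    then show "scalars #>\<^bsub>GL\<^esub> x = x <#\<^bsub>GL\<^esub> scalars"
      using comm[of x] by (auto simp: r_coset_def l_coset_def GL_def)
  qed
qed

lemma group_PGL: "group PGL"
  unfolding PGL_def by (rule normal.factorgroup_is_group[OF normal_scalars_GL])

lemma GL_image_span:
  assumes "f \<in> carrier GL"
  shows "f ` vec.span {v} = vec.span {f v}"
proof -
  interpret f: Vector_Spaces.linear "(*s)" "(*s)" f using assms by (simp add: GL_def)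
  show ?thesis using f.span_image[of "{v}"] by simp
qed

lemma scalars_image_PG:
  assumes "s \<in> scalars" "P \<in> PG"
  shows "s ` P = P"
proof -
  obtain c v where c: "c \<noteq> 0" "s = (*s) c" and v: "P = vec.span {v}"
    using assms by (auto simp: scalars_def PG_def)
  have "s ` P = vec.span {c *s v}"
    using GL_image_span[of s v] assms(1) scalars_subset_GL c v by auto
  also have "\<dots> = P"
  proof -
    have "v = inverse c *s (c *s v)" using c(1) by simp
    then have "v \<in> vec.span {c *s v}"
      by (metis vec.span_base vec.span_scale singletonI)
    moreover have "c *s v \<in> vec.span {v}"
      by (simp add: vec.span_base vec.span_scale)
    ultimately show ?thesis
      unfolding v by (intro subset_antisym vec.span_minimal) auto
  qed
  finally show ?thesis .
qed

lemma GL_image_PG: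
  assumes "f \<in> carrier GL" "P \<in> PG"
  shows "f ` P \<in> PG"
proof -
  obtain v where v: "v \<noteq> 0" "P = vec.span {v}" using assms(2) by (auto simp: PG_def)
  interpret f: Vector_Spaces.linear "(*s)" "(*s)" f using assms by (simp add: GL_def)
  have "inj f" using assms by (simp add: GL_def bij_is_inj)
  then have "f v \<noteq> 0" using v(1) f.zero by (metis injD)
  then show ?thesis using GL_image_span[OF assms(1)] v by (auto simp: PG_def)
qed

lemma PGL_act_coset:
  assumes "f \<in> carrier GL" "P \<in> PG"
  shows "PGL_act (scalars #>\<^bsub>GL\<^esub> f) P = f ` P"
proof -
  have "(s \<circ> f) ` P = f ` P" if "s \<in> scalars" for s
    using scalars_image_PG[OF that GL_image_PG[OF assms]] by (simp add: image_comp)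
  moreover have "id \<in> scalars"
    by (auto simp: scalars_def fun_eq_iff intro: exI[of _ 1])
  ultimately show ?thesis
    using assms(2) by (auto simp: PGL_act_def r_coset_def GL_def simp del: image_comp)
qed

lemma carrier_PGL: "carrier PGL = (\<lambda>f. scalars #>\<^bsub>GL\<^esub> f) ` carrier GL"
  by (simp add: PGL_def carrier_FactGroup)

lemma group_action_PGL: "group_action (PGL :: ('a::field ^ 'n \<Rightarrow> 'a ^ 'n) set monoid) PG PGL_act"
proof -
  interpret GL: group "GL :: ('a ^ 'n \<Rightarrow> 'a ^ 'n) monoid" by (rule group_GL)
  interpret N: normal scalars "GL :: ('a ^ 'n \<Rightarrow> 'a ^ 'n) monoid" by (rule normal_scalars_GL)
  have Bij: "PGL_act C \<in> Bij PG" if C: "C \<in> carrier PGL" for C :: "('a ^ 'n \<Rightarrow> 'a ^ 'n) set"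
  proof -
    obtain f where f: "f \<in> carrier GL" "C = scalars #>\<^bsub>GL\<^esub> f" using C unfolding carrier_PGL image_iff by auto
    define g where "g = inv\<^bsub>GL\<^esub> f"
    have g: "g \<in> carrier GL" using f by (simp add: g_def)
    have gf: "g \<circ> f = id" "f \<circ> g = id"
      using GL.l_inv[OF f(1)] GL.r_inv[OF f(1)] by (simp_all add: GL_def g_def)
    have "bij_betw (PGL_act C) PG PG"
    proof (rule bij_betw_byWitness[where f' = "\<lambda>P. g ` P"])
      show "\<forall>P\<in>PG. g ` PGL_act C P = P"
        using f gf by (simp add: PGL_act_coset image_comp)
      show "\<forall>P\<in>PG. PGL_act C (g ` P) = P"
        using f g gf by (simp add: PGL_act_coset GL_image_PG image_comp)
      show "PGL_act C ` PG \<subseteq> PG"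
        using f by (simp add: image_subset_iff PGL_act_coset GL_image_PG)
      show "(`) g ` PG \<subseteq> PG"
        using g by (simp add: image_subset_iff GL_image_PG)
    qed
    then show ?thesis by (simp add: Bij_def PGL_act_def)
  qed
  have mult: "PGL_act (C \<otimes>\<^bsub>PGL\<^esub> D) = PGL_act C \<otimes>\<^bsub>BijGroup PG\<^esub> PGL_act D"
    if C: "C \<in> carrier PGL" and D: "D \<in> carrier PGL" for C D :: "('a ^ 'n \<Rightarrow> 'a ^ 'n) set"
  proof -
    obtain f g where f: "f \<in> carrier GL" "C = scalars #>\<^bsub>GL\<^esub> f"
      and g: "g \<in> carrier GL" "D = scalars #>\<^bsub>GL\<^esub> g" using C D unfolding carrier_PGL image_iff by auto
    have CD: "C \<otimes>\<^bsub>PGL\<^esub> D = scalars #>\<^bsub>GL\<^esub> (f \<circ> g)"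
      using N.rcos_sum[OF f(1) g(1)] f g by (simp add: PGL_def) (simp add: GL_def)
    have fg: "f \<circ> g \<in> carrier GL" using GL.m_closed[OF f(1) g(1)] by (simp add: GL_def)
    show ?thesis
    proof
      fix P :: "('a ^ 'n) set"
      show "PGL_act (C \<otimes>\<^bsub>PGL\<^esub> D) P = (PGL_act C \<otimes>\<^bsub>BijGroup PG\<^esub> PGL_act D) P"
      proof (cases "P \<in> PG")
        case True
        then show ?thesis
          unfolding CD using PGL_act_coset[OF fg True] Bij[OF C] Bij[OF D] f g
          by (simp add: BijGroup_def compose_def PGL_act_coset GL_image_PG image_comp)
      next
        case False
        then show ?thesis
          using Bij[OF C] Bij[OF D] by (simp add: BijGroup_def compose_def PGL_act_def)
      qed
    qed
  qed
  have "PGL_act \<in> hom PGL (BijGroup (PG :: ('a ^ 'n) set set))"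
  proof (rule homI)
    show "PGL_act C \<in> carrier (BijGroup PG)" if "C \<in> carrier PGL" for C :: "('a ^ 'n \<Rightarrow> 'a ^ 'n) set"
      using Bij[OF that] by (simp add: BijGroup_def)
  qed (rule mult)
  then show ?thesis
    unfolding group_action_def
    by (intro group_hom.intro group_PGL group_BijGroup group_hom_axioms.intro)
qed

lemma tensor3_nonzero:
  assumes "u \<noteq> 0" "v \<noteq> 0" "w \<noteq> 0"
  shows "tensor3 u v w \<noteq> 0"
proof -
  obtain i j k where "u $ i \<noteq> 0" "v $ j \<noteq> 0" "w $ k \<noteq> 0"
    using assms by (auto simp: vec_eq_iff)
  then have "tensor3 u v w $ (i, j, k) \<noteq> 0" by (simp add: tensor3_def)
  then show ?thesis by auto
qed

lemma segre_points_subset: "segre_points \<subseteq> PG"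
  unfolding segre_points_def PG_def using tensor3_nonzero by blast

lemma group_action_segre_stabilizer:
  "group_action (segre_stabilizer :: ('a::field tensor222 \<Rightarrow> 'a tensor222) set monoid) PG PGL_act"
proof -
  let ?X = "segre_points :: 'a tensor222 set set"
  let ?G = "PGL :: ('a tensor222 \<Rightarrow> 'a tensor222) set monoid"
  interpret A: group_action ?G PG PGL_act by (rule group_action_PGL)
  interpret G: group ?G by (rule group_PGL)
  interpret h: group_hom ?G "BijGroup PG" PGL_act by (rule A.group_hom)
  have img: "PGL_act (g \<otimes>\<^bsub>?G\<^esub> h) ` ?X = PGL_act g ` PGL_act h ` ?X"
    if "g \<in> carrier ?G" "h \<in> carrier ?G" for g h
    unfolding image_image
    by (rule image_cong[OF refl], rule A.composition_rule[OF _ that])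
      (use segre_points_subset in blast)
  have one: "PGL_act \<one>\<^bsub>?G\<^esub> ` ?X = ?X"
    unfolding A.id_eq_one[symmetric] using segre_points_subset by auto
  have sub: "subgroup (carrier segre_stabilizer) ?G"
  proof (rule G.subgroupI)
    fix g assume "g \<in> carrier (segre_stabilizer :: ('a tensor222 \<Rightarrow> 'a tensor222) set monoid)"
    then have g: "g \<in> carrier ?G" "PGL_act g ` ?X = ?X"
      by (auto simp: segre_stabilizer_def stabilizer_def)
    have "PGL_act (inv\<^bsub>?G\<^esub> g) ` ?X = ?X"
      using img[of "inv\<^bsub>?G\<^esub> g" g] g one by simp
    then show "inv\<^bsub>?G\<^esub> g \<in> carrier segre_stabilizer"
      using g by (auto simp: segre_stabilizer_def stabilizer_def)
  next
    show "carrier segre_stabilizer \<noteq> ({} :: ('a tensor222 \<Rightarrow> 'a tensor222) set set)"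
      using one G.one_closed unfolding segre_stabilizer_def stabilizer_def by fastforce
  next
    fix g h assume "g \<in> carrier (segre_stabilizer :: ('a tensor222 \<Rightarrow> 'a tensor222) set monoid)"
      and "h \<in> carrier (segre_stabilizer :: ('a tensor222 \<Rightarrow> 'a tensor222) set monoid)"
    then show "g \<otimes>\<^bsub>?G\<^esub> h \<in> carrier segre_stabilizer"
      using img[of g h] by (simp add: segre_stabilizer_def stabilizer_def)
  qed (auto simp: segre_stabilizer_def stabilizer_def)
  have eq: "segre_stabilizer = ?G\<lparr>carrier := carrier segre_stabilizer\<rparr>"
    by (simp add: segre_stabilizer_def)
  have "group (segre_stabilizer :: ('a tensor222 \<Rightarrow> 'a tensor222) set monoid)"
    using G.subgroup_imp_group[OF sub] eq by simp
  moreover have "PGL_act \<in> hom segre_stabilizer (BijGroup (PG :: 'a tensor222 set set))"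
    using h.homh by (auto simp: hom_def segre_stabilizer_def stabilizer_def)
  ultimately show ?thesis
    unfolding group_action_def
    by (intro group_hom.intro group_BijGroup group_hom_axioms.intro)
qed

lemma tensor3_universal:
  fixes scale :: "'a::field \<Rightarrow> 'b::ab_group_add \<Rightarrow> 'b"
  assumes "\<And>v w. Vector_Spaces.linear (*s) scale (\<lambda>u. T u v w)"
    and "\<And>u w. Vector_Spaces.linear (*s) scale (\<lambda>v. T u v w)"
    and "\<And>u v. Vector_Spaces.linear (*s) scale (\<lambda>w. T u v w)"
  shows "\<exists>!L. Vector_Spaces.linear (*s) scale L \<and> (\<forall>u v w. L (tensor3 u v w) = T u v w)"
proof -
  interpret S: vector_space scale using assms(1) by (simp add: Vector_Spaces.linear_def)
  interpret T1: Vector_Spaces.linear "(*s)" scale "\<lambda>u. T u v w" for v w by fact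
  interpret T2: Vector_Spaces.linear "(*s)" scale "\<lambda>v. T u v w" for u w by fact
  interpret T3: Vector_Spaces.linear "(*s)" scale "\<lambda>w. T u v w" for u v by fact
  let ?e = "\<lambda>i. axis i 1 :: 'a ^ 2"
  have ex: "x = (\<Sum>i\<in>UNIV. x $ i *s ?e i)" for x :: "'a ^ 2"
    by (simp add: basis_expansion)
  have etens: "tensor3 (?e i) (?e j) (?e k) = axis (i, j, k) 1" for i j k
    by (auto simp: tensor3_def axis_def vec_eq_iff)
  have Texp: "T u v w = (\<Sum>i\<in>UNIV. \<Sum>j\<in>UNIV. \<Sum>k\<in>UNIV.
      scale (u $ i * v $ j * w $ k) (T (?e i) (?e j) (?e k)))" for u v w
  proof -
    have "T u v w = (\<Sum>i\<in>UNIV. scale (u $ i) (T (?e i) v w))"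
      by (subst ex[of u]) (simp add: T1.sum T1.scale)
    also have "\<dots> = (\<Sum>i\<in>UNIV. scale (u $ i) (\<Sum>j\<in>UNIV. scale (v $ j) (T (?e i) (?e j) w)))"
      by (subst ex[of v]) (simp add: T2.sum T2.scale)
    also have "\<dots> = (\<Sum>i\<in>UNIV. scale (u $ i) (\<Sum>j\<in>UNIV. scale (v $ j)
        (\<Sum>k\<in>UNIV. scale (w $ k) (T (?e i) (?e j) (?e k)))))"
      by (subst ex[of w]) (simp add: T3.sum T3.scale)
    finally show ?thesis by (simp add: S.scale_sum_right mult.assoc)
  qed
  define L where "L A = (\<Sum>(i, j, k)\<in>UNIV. scale (A $ (i, j, k)) (T (?e i) (?e j) (?e k)))" for A
  have L_alt: "L A = (\<Sum>i\<in>UNIV. \<Sum>j\<in>UNIV. \<Sum>k\<in>UNIV.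
      scale (A $ (i, j, k)) (T (?e i) (?e j) (?e k)))" for A
    unfolding L_def UNIV_Times_UNIV[symmetric]
    by (simp add: sum.cartesian_product case_prod_unfold del: UNIV_Times_UNIV)
  have linL: "Vector_Spaces.linear (*s) scale L"
    by unfold_locales
      (simp_all add: L_alt S.scale_left_distrib sum.distrib S.scale_sum_right)
  have LT: "L (tensor3 u v w) = T u v w" for u v w
    by (simp add: L_alt Texp[of u v w] tensor3_def)
  have "M = L" if linM: "Vector_Spaces.linear (*s) scale M" and M: "\<And>u v w. M (tensor3 u v w) = T u v w" for M
  proof
    fix A :: "'a tensor222"
    interpret M: Vector_Spaces.linear "(*s)" scale M by fact
    interpret L: Vector_Spaces.linear "(*s)" scale L by fact
    have e: "M (axis p 1) = L (axis p 1)" for p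
      by (cases p) (metis M LT etens)
    have A: "A = (\<Sum>p\<in>UNIV. A $ p *s axis p 1)" by (simp add: basis_expansion)
    show "M A = L A"
      by (subst (1 2) A) (simp add: M.sum M.scale L.sum L.scale e)
  qed
  with linL LT show ?thesis by blast
qed

end

theory Submission
  imports Defs
begin

text \<open>
  Two points lie in one orbit exactly when representing tensors are related by a linear bijection
  that preserves the set of nonzero pure tensors. Two different tools are needed, because the
  group of these bijections is not computed here. Known members (invertible maps on the three
  factors and permutations of the factors) bring every tensor to a normal form, and quantities
  defined from addition and purity alone, hence invariant under every member, tell the normal
  forms apart.

  Regard a tensor \<open>v\<close> as a bilinear map \<open>(\<phi>, \<psi>) \<mapsto> v(\<phi>, \<psi>, \<cdot>)\<close>, that is, as a
  two-dimensional algebra up to independent changes of basis in the two arguments and in the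
  values. If this algebra has zero divisors, the tensor can be moved to one with
  two vanishing entries, and elimination leaves four normal forms
  (\<open>degenerate_classification\<close>): \<open>e\<^sub>1\<otimes>e\<^sub>1\<otimes>e\<^sub>1\<close>, \<open>e\<^sub>1\<otimes>(e\<^sub>1\<otimes>e\<^sub>1 + e\<^sub>2\<otimes>e\<^sub>2)\<close>, the tangent form
  \<open>e\<^sub>1\<otimes>e\<^sub>1\<otimes>e\<^sub>2 + e\<^sub>1\<otimes>e\<^sub>2\<otimes>e\<^sub>1 + e\<^sub>2\<otimes>e\<^sub>1\<otimes>e\<^sub>1\<close> and the secant form
  \<open>e\<^sub>1\<otimes>e\<^sub>1\<otimes>e\<^sub>1 + e\<^sub>2\<otimes>e\<^sub>2\<otimes>e\<^sub>2\<close>. If it has none, it becomes the multiplication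
  table of a quadratic extension field \<open>F[\<theta>]\<close> with \<open>\<theta>\<^sup>2 = \<alpha> + \<beta>\<theta>\<close> in the basis \<open>1, \<theta>\<close>
  (\<open>classification\<close>). Over an algebraically closed field there is no such extension. Over a
  finite field there is one, and the choice of the generator \<open>\<theta>\<close> is the only freedom in the
  table, so that all these tensors are equivalent (\<open>field_forms_equivalent\<close>).

  The invariants are based on ways of writing \<open>v\<close> as a sum of two pure tensors. The secant form
  has one such way and the second form has several. The tangent form and the field forms have
  none, but the tangent form is a sum of three pure tensors collinear with a common pure tensor,
  which forces zero divisors (\<open>tangent_imp_degenerate\<close>).
\<close>

section \<open>Orbits of points as equivalence classes of tensors\<close>

definition pure :: "'a::field tensor222 set" where
  "pure = {tensor3 u v w | u v w. u \<noteq> 0 \<and> v \<noteq> 0 \<and> w \<noteq> 0}"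

definition segre_auts :: "('a::field tensor222 \<Rightarrow> 'a tensor222) set" where
  "segre_auts = {f \<in> carrier GL. f ` pure = pure}"

definition equivalent :: "'a::field tensor222 \<Rightarrow> 'a tensor222 \<Rightarrow> bool" (infix "\<simeq>" 50) where
  "v \<simeq> w \<longleftrightarrow> (\<exists>f\<in>segre_auts. f v = w)"

lemma span_eq_iff:
  fixes v w :: "'a::field ^ 'n"
  assumes "w \<noteq> 0"
  shows "vec.span {v} = vec.span {w} \<longleftrightarrow> (\<exists>c. c \<noteq> 0 \<and> w = c *s v)"
proof
  assume "vec.span {v} = vec.span {w}"
  then have "w \<in> vec.span {v}" by (simp add: vec.span_base)
  then obtain c where c: "w = c *s v" by (auto simp: vec.span_singleton)
  with assms have "c \<noteq> 0" by auto
  with c show "\<exists>c. c \<noteq> 0 \<and> w = c *s v" by blast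
next
  assume "\<exists>c. c \<noteq> 0 \<and> w = c *s v"
  then obtain c where c: "c \<noteq> 0" "w = c *s v" by blast
  then have v: "v = inverse c *s w" by simp
  have "w \<in> vec.span {v}" by (subst c(2)) (rule vec.span_scale, rule vec.span_base, simp)
  moreover have "v \<in> vec.span {w}" by (subst v) (rule vec.span_scale, rule vec.span_base, simp)
  ultimately show "vec.span {v} = vec.span {w}"
    by (intro subset_antisym vec.span_minimal) auto
qed

lemma tensor3_scale: "c *s tensor3 u v w = tensor3 (c *s u) v w"
  by (auto simp: tensor3_def vec_eq_iff)

lemma pure_scale: "x \<in> pure \<Longrightarrow> c \<noteq> 0 \<Longrightarrow> c *s x \<in> pure"
  unfolding pure_def mem_Collect_eq
  by (metis tensor3_scale vector_mul_eq_0)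

lemma pure_nonzero: "x \<in> pure \<Longrightarrow> x \<noteq> 0"
  by (auto simp: pure_def tensor3_nonzero)

lemma segre_points_eq: "segre_points = (\<lambda>x. vec.span {x}) ` pure"
  by (auto simp: segre_points_def pure_def)

lemma span_in_segre_points_iff:
  "x \<noteq> 0 \<Longrightarrow> vec.span {x} \<in> segre_points \<longleftrightarrow> x \<in> pure"
  unfolding segre_points_eq image_iff
  by (metis span_eq_iff pure_scale)

lemma GL_nonzero: "f \<in> carrier GL \<Longrightarrow> f x = 0 \<longleftrightarrow> x = 0"
proof -
  assume f: "f \<in> carrier GL"
  then interpret f: Vector_Spaces.linear "(*s)" "(*s)" f by (simp add: GL_def)
  show ?thesis using f f.zero by (auto simp: GL_def bij_def inj_def)
qed

text \<open>
  Nonzero multiples of pure tensors are pure, so nothing is lost in passing from the points of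
  the Segre variety to the vectors that represent them.
\<close>

lemma stabilises_segre_points_iff:
  assumes f: "f \<in> carrier GL"
  shows "(`) f ` segre_points = segre_points \<longleftrightarrow> f ` pure = pure"
proof -
  have im: "(`) f ` segre_points = (\<lambda>x. vec.span {x}) ` (f ` pure)"
    unfolding segre_points_eq image_image GL_image_span[OF f] by simp
  show ?thesis
  proof
    assume eq: "(`) f ` segre_points = segre_points"
    show "f ` pure = pure"
    proof (intro subset_antisym subsetI)
      fix y assume y: "y \<in> f ` pure"
      then have "vec.span {y} \<in> segre_points" unfolding im[unfolded eq] by (rule imageI)
      moreover have "y \<noteq> 0" using y GL_nonzero[OF f] pure_nonzero by auto
      ultimately show "y \<in> pure" by (simp add: span_in_segre_points_iff)
    next
      fix y :: "'a tensor222" assume y: "y \<in> pure"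
      then have "vec.span {y} \<in> (\<lambda>x. vec.span {x}) ` (f ` pure)"
        unfolding im[unfolded eq, symmetric] segre_points_eq by (rule imageI)
      then obtain x where x: "x \<in> pure" "vec.span {f x} = vec.span {y}"
        by (metis (no_types, lifting) imageE)
      then obtain c where c: "c \<noteq> 0" "y = c *s f x"
        using span_eq_iff[OF pure_nonzero[OF y]] by blast
      interpret f: Vector_Spaces.linear "(*s)" "(*s)" f using f by (simp add: GL_def)
      have "y = f (c *s x)" using c by (simp add: f.scale)
      then show "y \<in> f ` pure" using pure_scale[OF x(1) c(1)] by blast
    qed
  next
    assume "f ` pure = pure"
    then show "(`) f ` segre_points = segre_points"
      unfolding im unfolding segre_points_eq by simp
  qed
qed

lemma carrier_segre_stabilizer:
  "carrier segre_stabilizer = (\<lambda>f. scalars #>\<^bsub>GL\<^esub> f) ` segre_auts"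
proof -
  have "(PGL_act (scalars #>\<^bsub>GL\<^esub> f) ` segre_points = segre_points) = (f ` pure = pure)"
    if f: "f \<in> carrier GL" for f :: "'a tensor222 \<Rightarrow> 'a tensor222"
  proof -
    have "PGL_act (scalars #>\<^bsub>GL\<^esub> f) ` segre_points = (`) f ` segre_points"
      using segre_points_subset by (intro image_cong refl PGL_act_coset f) auto
    then show ?thesis using stabilises_segre_points_iff[OF f] by simp
  qed
  then show ?thesis
    by (auto simp: segre_stabilizer_def stabilizer_def carrier_PGL segre_auts_def)
qed

lemma orbit_span:
  assumes "v \<noteq> 0"
  shows "orbit segre_stabilizer PGL_act (vec.span {v}) = {vec.span {w} | w. v \<simeq> w}"
proof -
  have P: "vec.span {v} \<in> PG" using assms unfolding PG_def by blast
  have "PGL_act (scalars #>\<^bsub>GL\<^esub> f) (vec.span {v}) = vec.span {f v}" if "f \<in> segre_auts" for f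
    using that PGL_act_coset[OF _ P] GL_image_span[of f v] by (simp add: segre_auts_def)
  then have "orbit segre_stabilizer PGL_act (vec.span {v}) = (\<lambda>f. vec.span {f v}) ` segre_auts"
    unfolding orbit_def carrier_segre_stabilizer by blast
  then show ?thesis unfolding equivalent_def by blast
qed

lemma segre_autsI:
  fixes f g :: "'a::field tensor222 \<Rightarrow> 'a tensor222"
  assumes "Vector_Spaces.linear (*s) (*s) f"
    and "\<And>x. g (f x) = x" "\<And>x. f (g x) = x"
    and "\<And>x. x \<in> pure \<Longrightarrow> f x \<in> pure" "\<And>x. x \<in> pure \<Longrightarrow> g x \<in> pure"
  shows "f \<in> segre_auts"
proof -
  have "bij f" using assms(2,3) by (intro o_bij[of g]) (auto simp: fun_eq_iff)
  moreover have "f ` pure = pure"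
  proof (intro subset_antisym subsetI)
    fix y :: "'a tensor222" assume "y \<in> pure"
    then show "y \<in> f ` pure" using assms(3)[of y] assms(5) by (metis imageI)
  qed (use assms(4) in blast)
  ultimately show ?thesis using assms(1) by (simp add: segre_auts_def GL_def)
qed

lemma segre_auts_comp:
  assumes "f \<in> segre_auts" "g \<in> segre_auts"
  shows "f \<circ> g \<in> segre_auts"
proof -
  have "(f \<circ> g) ` pure = f ` (g ` pure)" by (rule image_comp[symmetric])
  then have "(f \<circ> g) ` pure = pure" using assms by (simp add: segre_auts_def)
  then show ?thesis
    using assms by (auto simp: segre_auts_def GL_def intro: Vector_Spaces.linear_compose bij_comp)
qed

lemma segre_auts_inv:
  assumes "f \<in> segre_auts"
  shows "inv_into UNIV f \<in> segre_auts"
proof -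
  interpret group "GL :: ('a tensor222 \<Rightarrow> 'a tensor222) monoid" by (rule group_GL)
  have f: "f \<in> carrier GL" "f ` pure = pure" "bij f" using assms by (auto simp: segre_auts_def GL_def)
  obtain g where g: "g \<in> carrier GL" "g \<circ> f = id"
    using l_inv_ex[OF f(1)] by (auto simp: GL_def)
  then have "inv_into UNIV f = g"
    by (metis f(3) bij_is_inj bij_is_surj comp_assoc comp_id id_comp surj_iff)
  moreover have "g ` pure = pure" by (metis f(2) g(2) image_comp image_id id_apply)
  ultimately show ?thesis using g by (simp add: segre_auts_def)
qed

lemma equivalent_refl: "v \<simeq> v"
  unfolding equivalent_def
  by (intro bexI[of _ id] segre_autsI[of _ id]) (auto simp: vec.linear_id)

lemma equivalent_sym:
  assumes "v \<simeq> w"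
  shows "w \<simeq> v"
proof -
  obtain f where f: "f \<in> segre_auts" "f v = w" using assms by (auto simp: equivalent_def)
  then have "inv_into UNIV f w = v" by (auto simp: segre_auts_def GL_def bij_is_inj)
  then show ?thesis using segre_auts_inv[OF f(1)] unfolding equivalent_def by blast
qed

lemma equivalent_trans [trans]: "u \<simeq> v \<Longrightarrow> v \<simeq> w \<Longrightarrow> u \<simeq> w"
  unfolding equivalent_def using segre_auts_comp by (metis comp_apply)

text \<open>
  Homotheties preserve purity. Hence equivalence of tensors already absorbs the choice of a
  representative of a point.
\<close>

lemma equivalent_scale:
  assumes "c \<noteq> 0"
  shows "v \<simeq> c *s v"
  unfolding equivalent_def
  by (intro bexI[of _ "(*s) c"] segre_autsI[of _ "(*s) (inverse c)"])
    (use assms in \<open>auto simp: vec.linear_scale_self pure_scale\<close>)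

lemma orbit_eq_iff:
  assumes "v \<noteq> 0" "w \<noteq> 0"
  shows "orbit segre_stabilizer PGL_act (vec.span {v}) = orbit segre_stabilizer PGL_act (vec.span {w})
    \<longleftrightarrow> v \<simeq> w"
proof
  assume "orbit segre_stabilizer PGL_act (vec.span {v}) = orbit segre_stabilizer PGL_act (vec.span {w})"
  moreover have "vec.span {w} \<in> orbit segre_stabilizer PGL_act (vec.span {w})"
    unfolding orbit_span[OF assms(2)] using equivalent_refl by blast
  ultimately have "vec.span {w} \<in> {vec.span {w} | w. v \<simeq> w}"
    using orbit_span[OF assms(1)] by simp
  then obtain x where x: "v \<simeq> x" "vec.span {x} = vec.span {w}" by auto
  then obtain c where "c \<noteq> 0" "w = c *s x" using span_eq_iff[OF assms(2)] by blast
  then show "v \<simeq> w" using equivalent_trans[OF x(1)] equivalent_scale by blast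
next
  assume "v \<simeq> w"
  then have "v \<simeq> x \<longleftrightarrow> w \<simeq> x" for x
    using equivalent_trans[of v w x] equivalent_trans[of w v x] equivalent_sym[of v w] by blast
  then show "orbit segre_stabilizer PGL_act (vec.span {v}) = orbit segre_stabilizer PGL_act (vec.span {w})"
    unfolding orbit_span[OF assms(1)] orbit_span[OF assms(2)] by simp
qed

text \<open>
  This turns the count of orbits into pure linear algebra: it suffices to exhibit a set of
  pairwise inequivalent normal forms that reaches every nonzero tensor.
\<close>

lemma card_orbits_transversal:
  fixes N :: "'a::field tensor222 set"
  assumes "\<And>v. v \<noteq> 0 \<Longrightarrow> \<exists>n\<in>N. v \<simeq> n"
    and "\<And>m n. m \<in> N \<Longrightarrow> n \<in> N \<Longrightarrow> m \<simeq> n \<Longrightarrow> m = n"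
    and "0 \<notin> N"
  shows "card (orbits (segre_stabilizer :: ('a tensor222 \<Rightarrow> 'a tensor222) set monoid) PG PGL_act) = card N"
proof -
  let ?orb = "\<lambda>v :: 'a tensor222. orbit segre_stabilizer PGL_act (vec.span {v})"
  have "orbits segre_stabilizer (PG :: 'a tensor222 set set) PGL_act = ?orb ` {v. v \<noteq> 0}"
    unfolding orbits_def PG_def by blast
  also have "\<dots> = ?orb ` N"
  proof (intro subset_antisym subsetI)
    fix P assume "P \<in> ?orb ` {v. v \<noteq> 0}"
    then obtain v where v: "v \<noteq> 0" "P = ?orb v" by auto
    with assms(1) obtain n where n: "n \<in> N" "v \<simeq> n" by blast
    then have "n \<noteq> 0" using assms(3) by auto
    then show "P \<in> ?orb ` N" using orbit_eq_iff[OF v(1)] n v by blast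
  qed (use assms(3) in auto)
  finally have "orbits segre_stabilizer (PG :: 'a tensor222 set set) PGL_act = ?orb ` N" .
  moreover have "inj_on ?orb N"
  proof (rule inj_onI)
    fix m n assume mn: "m \<in> N" "n \<in> N" "?orb m = ?orb n"
    then have "m \<noteq> 0" "n \<noteq> 0" using assms(3) by auto
    then have "m \<simeq> n" using mn(3) orbit_eq_iff by blast
    then show "m = n" using assms(2) mn(1,2) by blast
  qed
  ultimately show ?thesis by (simp add: card_image)
qed

section \<open>Coordinates and explicit symmetries\<close>

text \<open>
  The eight coordinates are listed in lexicographic order 111, 112, 121, 122, 211, 212, 221, 222:
  the first four form the slice with first index 1, and inside a slice the entries are grouped
  by the second index.
\<close>

definition tens :: "'a \<Rightarrow> 'a \<Rightarrow> 'a \<Rightarrow> 'a \<Rightarrow> 'a \<Rightarrow> 'a \<Rightarrow> 'a \<Rightarrow> 'a \<Rightarrow> 'a::field tensor222" where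
  "tens a b c d e f g h = (\<chi> p. case p of (i, j, k) \<Rightarrow>
     if i = 1 then if j = 1 then if k = 1 then a else b else if k = 1 then c else d
     else if j = 1 then if k = 1 then e else f else if k = 1 then g else h)"

lemma tens_nth [simp]:
  "tens a b c d e f g h $ (1, 1, 1) = a" "tens a b c d e f g h $ (1, 1, 2) = b"
  "tens a b c d e f g h $ (1, 2, 1) = c" "tens a b c d e f g h $ (1, 2, 2) = d"
  "tens a b c d e f g h $ (2, 1, 1) = e" "tens a b c d e f g h $ (2, 1, 2) = f"
  "tens a b c d e f g h $ (2, 2, 1) = g" "tens a b c d e f g h $ (2, 2, 2) = h"
  by (simp_all add: tens_def)

lemma tensor222_eq_iff:
  "v = (w :: 'a tensor222) \<longleftrightarrow>
     v $ (1, 1, 1) = w $ (1, 1, 1) \<and> v $ (1, 1, 2) = w $ (1, 1, 2) \<and>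
     v $ (1, 2, 1) = w $ (1, 2, 1) \<and> v $ (1, 2, 2) = w $ (1, 2, 2) \<and>
     v $ (2, 1, 1) = w $ (2, 1, 1) \<and> v $ (2, 1, 2) = w $ (2, 1, 2) \<and>
     v $ (2, 2, 1) = w $ (2, 2, 1) \<and> v $ (2, 2, 2) = w $ (2, 2, 2)"
  by (auto simp: vec_eq_iff forall_2)

lemma tens_eq_iff:
  "tens a b c d e f g h = tens a' b' c' d' e' f' g' h' \<longleftrightarrow>
     a = a' \<and> b = b' \<and> c = c' \<and> d = d' \<and> e = e' \<and> f = f' \<and> g = g' \<and> h = h'"
  by (simp add: tensor222_eq_iff)

lemma tens_cases:
  obtains a b c d e f g h where "v = tens a b c d e f g h"
  by (rule that[of "v $ (1, 1, 1)" "v $ (1, 1, 2)" "v $ (1, 2, 1)" "v $ (1, 2, 2)"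
        "v $ (2, 1, 1)" "v $ (2, 1, 2)" "v $ (2, 2, 1)" "v $ (2, 2, 2)"])
    (simp add: tensor222_eq_iff)

lemma tens_add: "tens a b c d e f g h + tens a' b' c' d' e' f' g' h' =
    tens (a + a') (b + b') (c + c') (d + d') (e + e') (f + f') (g + g') (h + h')"
  by (simp add: tensor222_eq_iff)

lemma tens_diff: "tens a b c d e f g h - tens a' b' c' d' e' f' g' h' =
    tens (a - a') (b - b') (c - c') (d - d') (e - e') (f - f') (g - g') (h - h')"
  by (simp add: tensor222_eq_iff)

lemma tens_eq_0_iff: "tens a b c d e f g h = 0 \<longleftrightarrow>
    a = 0 \<and> b = 0 \<and> c = 0 \<and> d = 0 \<and> e = 0 \<and> f = 0 \<and> g = 0 \<and> h = 0"
  by (simp add: tensor222_eq_iff)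

lemma tensor3_eq_tens: "tensor3 u v w =
    tens (u$1 * v$1 * w$1) (u$1 * v$1 * w$2) (u$1 * v$2 * w$1) (u$1 * v$2 * w$2)
         (u$2 * v$1 * w$1) (u$2 * v$1 * w$2) (u$2 * v$2 * w$1) (u$2 * v$2 * w$2)"
  by (simp add: tensor222_eq_iff tensor3_def)

text \<open>
  Only the action on the first factor is treated directly; transposing factors carries it over to
  the other two.
\<close>

definition act :: "'a \<Rightarrow> 'a \<Rightarrow> 'a \<Rightarrow> 'a \<Rightarrow> 'a::field tensor222 \<Rightarrow> 'a tensor222" where
  "act p q r s v = (\<chi> x. case x of (i, j, k) \<Rightarrow> if i = 1 then p * v $ (1, j, k) + q * v $ (2, j, k)
                                 else r * v $ (1, j, k) + s * v $ (2, j, k))"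

definition swap12 :: "'a::field tensor222 \<Rightarrow> 'a tensor222" where
  "swap12 v = (\<chi> p. case p of (i, j, k) \<Rightarrow> v $ (j, i, k))"

definition swap23 :: "'a::field tensor222 \<Rightarrow> 'a tensor222" where
  "swap23 v = (\<chi> p. case p of (i, j, k) \<Rightarrow> v $ (i, k, j))"

lemma act_pure:
  assumes "p * s - q * r \<noteq> 0" "x \<in> pure"
  shows "act p q r s x \<in> pure"
proof -
  obtain u v w where x: "x = tensor3 u v w" "u \<noteq> 0" "v \<noteq> 0" "w \<noteq> 0"
    using assms(2) by (auto simp: pure_def)
  let ?u = "vector [p * u $ 1 + q * u $ 2, r * u $ 1 + s * u $ 2] :: 'a ^ 2"
  have "act p q r s x = tensor3 ?u v w"
    by (simp add: x act_def tensor3_def tensor222_eq_iff algebra_simps)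
  moreover have "?u \<noteq> 0"
  proof
    assume "?u = 0"
    then have 0: "p * u $ 1 + q * u $ 2 = 0" "r * u $ 1 + s * u $ 2 = 0"
      by (simp_all add: vec_eq_iff forall_2)
    have "(p * s - q * r) * u $ 1 = 0" "(p * s - q * r) * u $ 2 = 0"
      using 0 by algebra+
    then show False using assms(1) x(2) by (simp add: vec_eq_iff forall_2)
  qed
  ultimately show ?thesis using x unfolding pure_def by blast
qed

lemma swap12_pure: "x \<in> pure \<Longrightarrow> swap12 x \<in> pure"
proof -
  have "swap12 (tensor3 u v w) = tensor3 v u w" for u v w :: "'a ^ 2"
    by (simp add: swap12_def tensor3_def tensor222_eq_iff mult.commute)
  then show "x \<in> pure \<Longrightarrow> swap12 x \<in> pure" unfolding pure_def by fastforce
qed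

lemma swap23_pure: "x \<in> pure \<Longrightarrow> swap23 x \<in> pure"
proof -
  have "swap23 (tensor3 u v w) = tensor3 u w v" for u v w :: "'a ^ 2"
    by (simp add: swap23_def tensor3_def tensor222_eq_iff algebra_simps)
  then show "x \<in> pure \<Longrightarrow> swap23 x \<in> pure" unfolding pure_def by fastforce
qed

lemma equivalent_act:
  assumes D: "p * s - q * r \<noteq> 0"
  shows "v \<simeq> act p q r s v"
proof -
  define D where "D = p * s - q * r"
  have D0: "D \<noteq> 0" using D by (simp add: D_def)
  have inv: "act p q r s (act (s/D) (-q/D) (-r/D) (p/D) x) = x"
            "act (s/D) (-q/D) (-r/D) (p/D) (act p q r s x) = x" for x
    using D0 by (simp_all add: tensor222_eq_iff act_def field_simps) (simp_all add: D_def algebra_simps)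
  have "s / D * (p / D) - - q / D * (- r / D) = D / (D * D)"
    by (simp add: D_def diff_divide_distrib mult.commute)
  then have "s / D * (p / D) - - q / D * (- r / D) \<noteq> 0" using D0 by simp
  moreover have "Vector_Spaces.linear (*s) (*s) (act p q r s)"
    by unfold_locales (simp_all add: act_def tensor222_eq_iff algebra_simps)
  ultimately have "act p q r s \<in> segre_auts"
    using inv act_pure D by (intro segre_autsI[of _ "act (s/D) (-q/D) (-r/D) (p/D)"])
  then show ?thesis unfolding equivalent_def by blast
qed

lemma equivalent_swap12: "v \<simeq> swap12 v"
proof -
  have "swap12 \<in> segre_auts"
    by (intro segre_autsI[of _ swap12] swap12_pure; (unfold_locales)?)
      (simp_all add: swap12_def tensor222_eq_iff)
  then show ?thesis unfolding equivalent_def by blast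
qed

lemma equivalent_swap23: "v \<simeq> swap23 v"
proof -
  have "swap23 \<in> segre_auts"
    by (intro segre_autsI[of _ swap23] swap23_pure; (unfold_locales)?)
      (simp_all add: swap23_def tensor222_eq_iff)
  then show ?thesis unfolding equivalent_def by blast
qed

lemma equivalent_transpose12: "tens a b c d e f g h \<simeq> tens a b e f c d g h"
proof -
  have "swap12 (tens a b c d e f g h) = tens a b e f c d g h"
    by (simp add: swap12_def tensor222_eq_iff)
  then show ?thesis using equivalent_swap12 by metis
qed

lemma equivalent_transpose23: "tens a b c d e f g h \<simeq> tens a c b d e g f h"
proof -
  have "swap23 (tens a b c d e f g h) = tens a c b d e g f h"
    by (simp add: swap23_def tensor222_eq_iff)
  then show ?thesis using equivalent_swap23 by metis
qed

text \<open>
  The following three rules are the row operations of the classification: an invertible matrix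
  with rows \<open>(p, q)\<close> and \<open>(r, s)\<close> recombines the two slices in one of the three directions.
\<close>

lemma equivalent_factor1:
  assumes "p * s - q * r \<noteq> 0"
  shows "tens a b c d e f g h \<simeq>
    tens (p * a + q * e) (p * b + q * f) (p * c + q * g) (p * d + q * h)
         (r * a + s * e) (r * b + s * f) (r * c + s * g) (r * d + s * h)"
proof -
  have "act p q r s (tens a b c d e f g h) =
    tens (p * a + q * e) (p * b + q * f) (p * c + q * g) (p * d + q * h)
         (r * a + s * e) (r * b + s * f) (r * c + s * g) (r * d + s * h)"
    by (simp add: act_def tensor222_eq_iff)
  then show ?thesis using equivalent_act[OF assms] by metis
qed

lemma equivalent_factor2:
  assumes "p * s - q * r \<noteq> 0"
  shows "tens a b c d e f g h \<simeq>
    tens (p * a + q * c) (p * b + q * d) (r * a + s * c) (r * b + s * d)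
         (p * e + q * g) (p * f + q * h) (r * e + s * g) (r * f + s * h)"
  using equivalent_trans[OF equivalent_trans[OF equivalent_transpose12
      equivalent_factor1[OF assms]] equivalent_transpose12] .

lemma equivalent_factor3:
  assumes "p * s - q * r \<noteq> 0"
  shows "tens a b c d e f g h \<simeq>
    tens (p * a + q * b) (r * a + s * b) (p * c + q * d) (r * c + s * d)
         (p * e + q * f) (r * e + s * f) (p * g + q * h) (r * g + s * h)"
  using equivalent_trans[OF equivalent_trans[OF equivalent_transpose23
      equivalent_factor2[OF assms]] equivalent_transpose23] .


section \<open>Normal forms\<close>

text \<open>
  In \<open>field_form\<close>, the entries are the multiplication table of \<open>F[\<theta>]\<close> with
  \<open>\<theta>\<^sup>2 = \<alpha> + \<beta>\<theta>\<close>: indices 1 and 2 stand for \<open>1\<close> and \<open>\<theta>\<close>, and the third index reads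
  off the coordinates of the product of the first two.
\<close>

abbreviation "decomposable_form \<equiv> tens 1 0 0 0 0 0 0 0"
abbreviation "slab_form \<equiv> tens 1 0 0 1 0 0 0 0"
abbreviation "tangent_form \<equiv> tens 0 1 1 0 1 0 0 0"
abbreviation "secant_form \<equiv> tens 1 0 0 0 0 0 0 1"
abbreviation "field_form \<alpha> \<beta> \<equiv> tens 1 0 0 1 0 1 \<alpha> \<beta>"

definition degenerate_forms :: "'a::field tensor222 set" where
  "degenerate_forms = {decomposable_form, slab_form, tangent_form, secant_form}"

definition contract :: "'a::field ^ 2 \<Rightarrow> 'a ^ 2 \<Rightarrow> 'a tensor222 \<Rightarrow> 2 \<Rightarrow> 'a" where
  "contract \<phi> \<psi> v k = (\<Sum>i\<in>UNIV. \<Sum>j\<in>UNIV. \<phi> $ i * \<psi> $ j * v $ (i, j, k))"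

definition degenerate :: "'a::field tensor222 \<Rightarrow> bool" where
  "degenerate v \<longleftrightarrow> (\<exists>\<phi> \<psi>. \<phi> \<noteq> 0 \<and> \<psi> \<noteq> 0 \<and> (\<forall>k. contract \<phi> \<psi> v k = 0))"

lemma vec2_eq_0_iff: "u = (0 :: 'a::field ^ 2) \<longleftrightarrow> u $ 1 = 0 \<and> u $ 2 = 0"
  by (simp add: vec_eq_iff forall_2)

lemma degenerate_tens_iff:
  "degenerate (tens a b c d e f g h) \<longleftrightarrow>
    (\<exists>p q x y. (p \<noteq> 0 \<or> q \<noteq> 0) \<and> (x \<noteq> 0 \<or> y \<noteq> 0) \<and>
      p * x * a + p * y * c + q * x * e + q * y * g = 0 \<and>
      p * x * b + p * y * d + q * x * f + q * y * h = 0)" (is "?L \<longleftrightarrow> ?R")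
proof
  assume ?L
  then obtain \<phi> \<psi> :: "'a ^ 2" where *: "\<phi> \<noteq> 0" "\<psi> \<noteq> 0"
    "\<And>k. contract \<phi> \<psi> (tens a b c d e f g h) k = 0" by (auto simp: degenerate_def)
  from * have "(\<phi> $ 1 \<noteq> 0 \<or> \<phi> $ 2 \<noteq> 0) \<and> (\<psi> $ 1 \<noteq> 0 \<or> \<psi> $ 2 \<noteq> 0) \<and>
      \<phi> $ 1 * \<psi> $ 1 * a + \<phi> $ 1 * \<psi> $ 2 * c + \<phi> $ 2 * \<psi> $ 1 * e + \<phi> $ 2 * \<psi> $ 2 * g = 0 \<and>
      \<phi> $ 1 * \<psi> $ 1 * b + \<phi> $ 1 * \<psi> $ 2 * d + \<phi> $ 2 * \<psi> $ 1 * f + \<phi> $ 2 * \<psi> $ 2 * h = 0"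
    using *(3)[of 1] *(3)[of 2] by (simp add: contract_def sum_2 vec2_eq_0_iff add.assoc)
  then show ?R by blast
next
  assume ?R
  then obtain p q x y where *: "p \<noteq> 0 \<or> q \<noteq> 0" "x \<noteq> 0 \<or> y \<noteq> 0"
      "p * x * a + p * y * c + q * x * e + q * y * g = 0"
      "p * x * b + p * y * d + q * x * f + q * y * h = 0" by blast
  show ?L unfolding degenerate_def
    by (rule exI[of _ "vector [p, q]"], rule exI[of _ "vector [x, y]"])
      (use * in \<open>simp add: contract_def sum_2 vec2_eq_0_iff forall_2 add.assoc\<close>)
qed

lemma equivalent_zero_iff: "v \<simeq> w \<Longrightarrow> v = 0 \<longleftrightarrow> w = 0"
  using GL_nonzero by (auto simp: equivalent_def segre_auts_def)

lemma complete_to_basis: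
  fixes p q :: "'a::field"
  assumes "p \<noteq> 0 \<or> q \<noteq> 0"
  obtains r s where "p * s - q * r \<noteq> 0"
  using that[of 1 0] that[of 0 1] assms by auto

lemma map_to_first_basis_vector:
  fixes x y :: "'a::field"
  assumes "x \<noteq> 0 \<or> y \<noteq> 0"
  shows "\<exists>p q r s. p * s - q * r \<noteq> 0 \<and> p * x + q * y = 1 \<and> r * x + s * y = 0"
proof (cases "x = 0")
  case True
  then have "0 * 0 - 1 / y * 1 \<noteq> 0 \<and> 0 * x + 1 / y * y = 1 \<and> 1 * x + 0 * y = 0"
    using assms by simp
  then show ?thesis by blast
next
  case False
  then have "1 / x * x - 0 * - y \<noteq> 0 \<and> 1 / x * x + 0 * y = 1 \<and> - y * x + x * y = 0" by simp
  then show ?thesis by blast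
qed

lemma map_to_standard_basis:
  fixes a b c d :: "'a::field"
  assumes "a * d - b * c \<noteq> 0"
  shows "\<exists>p q r s. p * s - q * r \<noteq> 0 \<and> p * a + q * b = 1 \<and> r * a + s * b = 0 \<and>
    p * c + q * d = 0 \<and> r * c + s * d = 1"
proof -
  define D where "D = a * d - b * c"
  have D0: "D \<noteq> 0" using assms by (simp add: D_def)
  have "d / D * (a / D) - - c / D * (- b / D) = D / (D * D)"
    by (simp add: D_def diff_divide_distrib mult.commute)
  then have "d / D * (a / D) - - c / D * (- b / D) \<noteq> 0" using D0 by simp
  moreover have "d / D * a + - c / D * b = 1" "- b / D * a + a / D * b = 0"
    "d / D * c + - c / D * d = 0" "- b / D * c + a / D * d = 1"
    using D0 by (simp_all add: field_simps) (simp_all add: D_def algebra_simps)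
  ultimately show ?thesis by blast
qed

lemma pure_equivalent_decomposable_form:
  assumes "v \<in> pure"
  shows "v \<simeq> decomposable_form"
proof -
  obtain x y z where v: "v = tensor3 x y z" "x \<noteq> 0" "y \<noteq> 0" "z \<noteq> 0"
    using assms by (auto simp: pure_def)
  obtain p q r s where 1: "p * s - q * r \<noteq> 0" "p * x $ 1 + q * x $ 2 = 1" "r * x $ 1 + s * x $ 2 = 0"
    using map_to_first_basis_vector[OF v(2)[unfolded vec2_eq_0_iff de_Morgan_conj]] by blast
  obtain p' q' r' s' where 2: "p' * s' - q' * r' \<noteq> 0" "p' * y $ 1 + q' * y $ 2 = 1" "r' * y $ 1 + s' * y $ 2 = 0"
    using map_to_first_basis_vector[OF v(3)[unfolded vec2_eq_0_iff de_Morgan_conj]] by blast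
  obtain p'' q'' r'' s'' where 3: "p'' * s'' - q'' * r'' \<noteq> 0" "p'' * z $ 1 + q'' * z $ 2 = 1" "r'' * z $ 1 + s'' * z $ 2 = 0"
    using map_to_first_basis_vector[OF v(4)[unfolded vec2_eq_0_iff de_Morgan_conj]] by blast
  have factor: "a * (b * t) + c * (d * t) = (a * b + c * d) * t" for a b c d t :: 'a
    by (simp add: algebra_simps)
  have x: "p * (x $ 1 * t) + q * (x $ 2 * t) = t" "r * (x $ 1 * t) + s * (x $ 2 * t) = 0" for t
    unfolding factor 1(2,3) by simp_all
  have y: "p' * (y $ 1 * t) + q' * (y $ 2 * t) = t" "r' * (y $ 1 * t) + s' * (y $ 2 * t) = 0" for t
    unfolding factor 2(2,3) by simp_all
  have "v \<simeq> tens (y$1 * z$1) (y$1 * z$2) (y$2 * z$1) (y$2 * z$2) 0 0 0 0"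
    unfolding v(1) tensor3_eq_tens mult.assoc
    using equivalent_factor1[OF 1(1), of "x$1 * (y$1 * z$1)" "x$1 * (y$1 * z$2)" "x$1 * (y$2 * z$1)"
        "x$1 * (y$2 * z$2)" "x$2 * (y$1 * z$1)" "x$2 * (y$1 * z$2)" "x$2 * (y$2 * z$1)" "x$2 * (y$2 * z$2)"]
    unfolding x .
  also have "tens (y$1 * z$1) (y$1 * z$2) (y$2 * z$1) (y$2 * z$2) 0 0 0 0 \<simeq> tens (z$1) (z$2) 0 0 0 0 0 0"
    using equivalent_factor2[OF 2(1), of "y$1 * z$1" "y$1 * z$2" "y$2 * z$1" "y$2 * z$2" 0 0 0 0]
    unfolding y by simp
  also have "tens (z$1) (z$2) 0 0 0 0 0 0 \<simeq> decomposable_form"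
    using equivalent_factor3[OF 3(1), of "z$1" "z$2" 0 0 0 0 0 0] unfolding 3(2,3) by simp
  finally show ?thesis .
qed

text \<open>
  With a single nonzero slice, the tensor is a 2 by 2 matrix up to row and column operations, so
  only its rank matters.
\<close>

lemma slab_classification:
  assumes "tens a b c d 0 0 0 0 \<noteq> 0"
  shows "\<exists>n\<in>degenerate_forms. tens a b c d 0 0 0 0 \<simeq> n"
proof (cases "a * d - b * c = 0")
  case False
  obtain p q r s where *: "p * s - q * r \<noteq> 0" "p * a + q * b = 1" "r * a + s * b = 0"
      "p * c + q * d = 0" "r * c + s * d = 1"
    using map_to_standard_basis[OF False] by blast
  have "tens a b c d 0 0 0 0 \<simeq> slab_form"
    using equivalent_factor3[OF *(1), of a b c d 0 0 0 0] unfolding *(2-) by simp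
  then show ?thesis by (auto simp: degenerate_forms_def)
next
  case True
  have "tens a b c d 0 0 0 0 \<in> pure"
  proof (cases "a = 0 \<and> b = 0")
    case True
    then have "tens a b c d 0 0 0 0 = tensor3 (vector [1, 0]) (vector [0, 1]) (vector [c, d])"
      by (simp add: tensor3_eq_tens tens_eq_iff)
    moreover have "vector [c, d] \<noteq> (0 :: 'a ^ 2)"
      using assms True by (auto simp: tens_eq_0_iff vec2_eq_0_iff)
    moreover have "vector [1, 0] \<noteq> (0 :: 'a ^ 2)" "vector [0, 1] \<noteq> (0 :: 'a ^ 2)"
      by (simp_all add: vec2_eq_0_iff)
    ultimately show ?thesis unfolding pure_def by blast
  next
    case False
    then obtain t where t: "c = t * a" "d = t * b"
    proof (cases "a = 0")
      case True
      then show ?thesis using that[of "d / b"] False \<open>a * d - b * c = 0\<close> by auto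
    next
      case a: False
      then show ?thesis using that[of "c / a"] \<open>a * d - b * c = 0\<close> by (auto simp: field_simps)
    qed
    then have "tens a b c d 0 0 0 0 = tensor3 (vector [1, 0]) (vector [1, t]) (vector [a, b])"
      by (simp add: tensor3_eq_tens tens_eq_iff)
    moreover have "vector [a, b] \<noteq> (0 :: 'a ^ 2)" "vector [1, 0] \<noteq> (0 :: 'a ^ 2)" "vector [1, t] \<noteq> (0 :: 'a ^ 2)"
      using False by (simp_all add: vec2_eq_0_iff)
    ultimately show ?thesis unfolding pure_def by blast
  qed
  then show ?thesis using pure_equivalent_decomposable_form by (auto simp: degenerate_forms_def)
qed

lemma classified_if_equivalent:
  "v \<simeq> w \<Longrightarrow> \<exists>n\<in>N. w \<simeq> n \<Longrightarrow> \<exists>n\<in>N. v \<simeq> n"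
  using equivalent_trans by blast

text \<open>
  The two middle pairs \<open>(c, d)\<close> and \<open>(e, f)\<close> are vectors of the third factor. If they are
  independent they serve as its basis, and the remaining pair is then cleared by operations on
  the first two factors, which leads to the secant form. If they are dependent, both are put on
  the first axis. Then either everything lies on that axis and a slab remains, or the last pair
  can be moved to the second axis, and the tangent form appears precisely when neither middle
  pair vanishes.
\<close>

lemma corner_free_classification:
  assumes "tens 0 0 c d e f g h \<noteq> 0"
  shows "\<exists>n\<in>degenerate_forms. tens 0 0 c d e f g h \<simeq> n"
proof (cases "c * f - d * e = 0")
  case False
  obtain p q r s where *: "p * s - q * r \<noteq> 0" "p * c + q * d = 1" "r * c + s * d = 0"
      "p * e + q * f = 0" "r * e + s * f = 1"
    using map_to_standard_basis[OF False] by blast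
  obtain g' h' where "tens 0 0 c d e f g h \<simeq> tens 0 0 1 0 0 1 g' h'"
    using equivalent_factor3[OF *(1), of 0 0 c d e f g h] unfolding *(2-) by simp
  also have "tens 0 0 1 0 0 1 g' h' \<simeq> tens 0 0 1 0 0 1 0 h'"
    using equivalent_factor1[of 1 1 0 "- g'" 0 0 1 0 0 1 g' h'] by simp
  also have "tens 0 0 1 0 0 1 0 h' \<simeq> tens 0 0 1 0 0 1 0 0"
    using equivalent_factor2[of 1 1 0 "- h'" 0 0 1 0 0 1 0 h'] by simp
  also have "tens 0 0 1 0 0 1 0 0 \<simeq> secant_form"
    using equivalent_factor2[of 0 0 1 1 0 0 1 0 0 1 0 0] by simp
  finally show ?thesis by (auto simp: degenerate_forms_def)
next
  case True
  \<comment> \<open>the second row annihilates both dependent vectors\<close>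
  obtain p q r s where *: "p * s - q * r \<noteq> 0" "r * c + s * d = 0" "r * e + s * f = 0"
  proof (cases "c = 0 \<and> d = 0")
    case True
    show ?thesis
    proof (cases "e = 0 \<and> f = 0")
      case True
      then show ?thesis using that[of 1 1 0 0] \<open>c = 0 \<and> d = 0\<close> by simp
    next
      case False
      then obtain p q r s where "p * s - q * r \<noteq> 0" "r * e + s * f = 0"
        using map_to_first_basis_vector[of e f] by blast
      then show ?thesis using that \<open>c = 0 \<and> d = 0\<close> by auto
    qed
  next
    case cd: False
    then obtain p q r s where 1: "p * s - q * r \<noteq> 0" "r * c + s * d = 0"
      using map_to_first_basis_vector[of c d] by blast
    have "c * (r * e + s * f) = 0" "d * (r * e + s * f) = 0" using 1(2) True by algebra+
    then show ?thesis using that 1 cd by auto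
  qed
  obtain l m g' h' where step: "tens 0 0 c d e f g h \<simeq> tens 0 0 l 0 m 0 g' h'"
    using equivalent_factor3[OF *(1), of 0 0 c d e f g h] unfolding *(2,3) by simp
  then have nz: "tens 0 0 l 0 m 0 g' h' \<noteq> 0" using equivalent_zero_iff assms by blast
  have one_slab: "\<exists>n\<in>degenerate_forms. tens 0 0 0 0 m 0 0 1 \<simeq> n" for m :: 'a
  proof -
    have "tens 0 0 0 0 m 0 0 1 \<simeq> tens m 0 0 1 0 0 0 0"
      using equivalent_factor1[of 0 0 1 1 0 0 0 0 m 0 0 1] by simp
    then show ?thesis by (rule classified_if_equivalent) (simp add: slab_classification tens_eq_0_iff)
  qed
  have "\<exists>n\<in>degenerate_forms. tens 0 0 l 0 m 0 g' h' \<simeq> n"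
  proof (cases "h' = 0")
    case True
    have "tens 0 0 l 0 m 0 g' 0 \<simeq> tens 0 l m g' 0 0 0 0"
      using equivalent_trans[OF equivalent_transpose23 equivalent_transpose12] .
    then show ?thesis unfolding True
      by (rule classified_if_equivalent) (use nz True in \<open>simp add: slab_classification tens_eq_0_iff\<close>)
  next
    case h': False
    have "tens 0 0 l 0 m 0 g' h' \<simeq> tens 0 0 l 0 m 0 0 1"
      using equivalent_factor3[of 1 "1 / h'" "- g' / h'" 0 0 0 l 0 m 0 g' h'] h' by simp
    moreover have "\<exists>n\<in>degenerate_forms. tens 0 0 l 0 m 0 0 1 \<simeq> n"
    proof -
      consider "l = 0" | "m = 0" | "l \<noteq> 0" "m \<noteq> 0" by blast
      then show ?thesis
      proof cases
        case 1
        then show ?thesis using one_slab by simp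
      next
        case 2
        show ?thesis
          by (rule classified_if_equivalent[OF equivalent_transpose12]) (use one_slab 2 in simp)
      next
        case 3
        have "tens 0 0 l 0 m 0 0 1 \<simeq> tens m 0 0 1 0 0 1 0"
          using equivalent_factor1[of 0 0 1 "1 / l" 0 0 l 0 m 0 0 1] 3 by simp
        also have "tens m 0 0 1 0 0 1 0 \<simeq> tangent_form"
          using equivalent_factor2[of 0 0 1 "1 / m" m 0 0 1 0 0 1 0] 3 by simp
        finally show ?thesis by (auto simp: degenerate_forms_def)
      qed
    qed
    ultimately show ?thesis by (rule classified_if_equivalent)
  qed
  then show ?thesis by (rule classified_if_equivalent[OF step])
qed

text \<open>
  Zero divisors \<open>(p, q)\<close> and \<open>(x, y)\<close> become first basis vectors when they are completed to
  the first rows of invertible matrices; this makes the corner pair vanish.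
\<close>

lemma degenerate_classification:
  assumes "degenerate v" "v \<noteq> 0"
  shows "\<exists>n\<in>degenerate_forms. v \<simeq> n"
proof -
  obtain a b c d e f g h where v: "v = tens a b c d e f g h" by (rule tens_cases)
  obtain p q x y where *: "p \<noteq> 0 \<or> q \<noteq> 0" "x \<noteq> 0 \<or> y \<noteq> 0"
      "p * x * a + p * y * c + q * x * e + q * y * g = 0"
      "p * x * b + p * y * d + q * x * f + q * y * h = 0"
    using assms(1) unfolding v degenerate_tens_iff by blast
  obtain r s where 1: "p * s - q * r \<noteq> 0" using complete_to_basis[OF *(1)] .
  obtain r' s' where 2: "x * s' - y * r' \<noteq> 0" using complete_to_basis[OF *(2)] .
  have 0: "x * (p * a + q * e) + y * (p * c + q * g) = 0"
          "x * (p * b + q * f) + y * (p * d + q * h) = 0"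
    using *(3,4) by algebra+
  obtain c' d' e' f' g' h' where step: "v \<simeq> tens 0 0 c' d' e' f' g' h'"
    using equivalent_trans[OF equivalent_factor1[OF 1] equivalent_factor2[OF 2]] unfolding v 0
    by (metis 0)
  then have "tens 0 0 c' d' e' f' g' h' \<noteq> 0" using equivalent_zero_iff assms(2) by blast
  then show ?thesis using corner_free_classification classified_if_equivalent[OF step] by blast
qed

text \<open>
  The algebra \<open>F[\<theta>]\<close> has zero divisors exactly when its defining quadratic has a root. A root
  \<open>x\<close> gives the factorisation \<open>(\<theta> - x)(\<theta> + x - \<beta>) = 0\<close>; conversely a zero product of
  \<open>p + q\<theta>\<close> with a nonzero element gives the root \<open>- p / q\<close>.
\<close>

lemma field_form_degenerate_iff:
  "degenerate (field_form \<alpha> \<beta>) \<longleftrightarrow> (\<exists>x. x\<^sup>2 = \<beta> * x + \<alpha>)"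
proof
  assume "degenerate (field_form \<alpha> \<beta>)"
  then obtain p q x y where *: "p \<noteq> 0 \<or> q \<noteq> 0" "x \<noteq> 0 \<or> y \<noteq> 0"
      "p * x + q * y * \<alpha> = 0" "p * y + q * x + q * y * \<beta> = 0"
    unfolding degenerate_tens_iff by auto
  have q: "q \<noteq> 0" and y: "y \<noteq> 0" using * by auto
  have "(- (p / q))\<^sup>2 = \<beta> * (- (p / q)) + \<alpha>"
  proof -
    have "y * (p * p + \<beta> * p * q - \<alpha> * q * q) = 0" using *(3,4) by algebra
    then have "p * p + \<beta> * p * q - \<alpha> * q * q = 0" using y by (metis mult_eq_0_iff)
    then have "p * p = \<alpha> * q * q - \<beta> * p * q" by algebra
    then show ?thesis using q by (simp add: field_simps power2_eq_square)
  qed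
  then show "\<exists>x. x\<^sup>2 = \<beta> * x + \<alpha>" by blast
next
  assume "\<exists>x. x\<^sup>2 = \<beta> * x + \<alpha>"
  then obtain x where x: "x\<^sup>2 = \<beta> * x + \<alpha>" by blast
  show "degenerate (field_form \<alpha> \<beta>)"
    unfolding degenerate_tens_iff
    by (rule exI[of _ "- x"], rule exI[of _ 1], rule exI[of _ "x - \<beta>"], rule exI[of _ 1])
      (use x in \<open>simp add: algebra_simps power2_eq_square\<close>)
qed

text \<open>
  Without zero divisors, multiplication by a fixed nonzero element is bijective. Hence the
  products of the two first basis vectors with a fixed \<open>1\<close> may be taken as the basis \<open>1, \<theta>\<close>
  of the values, and the second basis vector of the other argument may be chosen so that its
  product with the first \<open>1\<close> is again \<open>\<theta>\<close>. Only \<open>\<theta>\<^sup>2\<close> remains undetermined. Degeneracy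
  is not carried from one tensor to an equivalent one here: as soon as a degenerate tensor
  occurs on the way, \<open>degenerate_classification\<close> already gives a normal form.
\<close>

lemma classification:
  assumes "v \<noteq> 0"
  shows "(\<exists>n\<in>degenerate_forms. v \<simeq> n) \<or> (\<exists>\<alpha> \<beta>. v \<simeq> field_form \<alpha> \<beta> \<and> (\<nexists>x. x\<^sup>2 = \<beta> * x + \<alpha>))"
proof (rule disjCI)
  assume notfield: "\<not> (\<exists>\<alpha> \<beta>. v \<simeq> field_form \<alpha> \<beta> \<and> (\<nexists>x. x\<^sup>2 = \<beta> * x + \<alpha>))"
  show "\<exists>n\<in>degenerate_forms. v \<simeq> n"
  proof (rule ccontr)
    assume unclassified: "\<not> ?thesis"
    have nondeg: "\<not> degenerate w" if "v \<simeq> w" for w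
      using degenerate_classification[of w] classified_if_equivalent[OF that]
        equivalent_zero_iff[OF that] assms unclassified by blast
    obtain a b c d e f g h where v: "v = tens a b c d e f g h" by (rule tens_cases)
    have "a * f - b * e \<noteq> 0"
    proof
      assume D: "a * f - b * e = 0"
      have "\<exists>p q. (p \<noteq> 0 \<or> q \<noteq> 0) \<and> p * a + q * e = 0 \<and> p * b + q * f = 0"
      proof -
        consider "a \<noteq> 0 \<or> e \<noteq> 0" | "a = 0" "e = 0" "b \<noteq> 0 \<or> f \<noteq> 0" | "a = 0" "e = 0" "b = 0" "f = 0"
          by blast
        then show ?thesis
        proof cases
          case 1
          show ?thesis
            by (rule exI[of _ e], rule exI[of _ "- a"]) (use 1 D in \<open>auto simp: algebra_simps\<close>)
        next
          case 2
          show ?thesis by (rule exI[of _ f], rule exI[of _ "- b"]) (use 2 in auto)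
        next
          case 3
          then show ?thesis by (intro exI[of _ 1]) simp
        qed
      qed
      then obtain p q where *: "p \<noteq> 0 \<or> q \<noteq> 0" "p * a + q * e = 0" "p * b + q * f = 0" by blast
      have "degenerate v" unfolding v degenerate_tens_iff
        by (rule exI[of _ p], rule exI[of _ q], rule exI[of _ 1], rule exI[of _ 0]) (use * in simp)
      then show False using nondeg equivalent_refl by blast
    qed
    then obtain p q r s where *: "p * s - q * r \<noteq> 0" "p * a + q * b = 1" "r * a + s * b = 0"
        "p * e + q * f = 0" "r * e + s * f = 1"
      using map_to_standard_basis by blast
    \<comment> \<open>the values at (1, 1) and (2, 1) become the basis of the third factor\<close>
    obtain c' d' g' h' where step: "v \<simeq> tens 1 0 c' d' 0 1 g' h'"
      using equivalent_factor3[OF *(1), of a b c d e f g h] unfolding v *(2-) by blast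
    have d': "d' \<noteq> 0"
    proof
      assume "d' = 0"
      have "degenerate (tens 1 0 c' d' 0 1 g' h')" unfolding degenerate_tens_iff
        by (rule exI[of _ 1], rule exI[of _ 0], rule exI[of _ "- c'"], rule exI[of _ 1])
          (use \<open>d' = 0\<close> in simp)
      then show False using nondeg step by blast
    qed
    have "tens 1 0 c' d' 0 1 g' h' \<simeq> field_form (g' / d') ((h' - c') / d')"
      using equivalent_factor2[of 1 "1 / d'" 0 "- c' / d'" 1 0 c' d' 0 1 g' h'] d'
      by (simp add: diff_divide_distrib)
    with step have "v \<simeq> field_form (g' / d') ((h' - c') / d')" by (rule equivalent_trans)
    then show False using nondeg field_form_degenerate_iff notfield by blast
  qed
qed


section \<open>Invariants separating the orbits\<close>

text \<open>
  The unordered ways of writing \<open>v\<close> as a sum of two pure tensors correspond to pairs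
  \<open>x, v - x\<close> of elements of this set, so one way contributes two elements if its summands
  differ.
\<close>

definition decompositions :: "'a::field tensor222 \<Rightarrow> 'a tensor222 set" where
  "decompositions v = {x \<in> pure. v - x \<in> pure}"

text \<open>
  If \<open>y\<close> and \<open>x + y\<close> are pure along with \<open>x\<close>, the points of \<open>x\<close> and \<open>y\<close> coincide or span
  a line on the Segre variety. Such lines span the tangent space at \<open>x\<close>, which this
  definition describes by purity alone, as invariance requires.
\<close>

definition tangent :: "'a::field tensor222 \<Rightarrow> bool" where
  "tangent v \<longleftrightarrow> (\<exists>x y\<^sub>1 y\<^sub>2 y\<^sub>3. {x, y\<^sub>1, y\<^sub>2, y\<^sub>3, x + y\<^sub>1, x + y\<^sub>2, x + y\<^sub>3} \<subseteq> pure \<and> v = y\<^sub>1 + y\<^sub>2 + y\<^sub>3)"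

text \<open>
  For an infinite set the cardinality is 0 by convention, so that the value 2 also covers tensors
  with infinitely many decompositions.
\<close>

definition orbit_type :: "'a::field tensor222 \<Rightarrow> nat" where
  "orbit_type v =
    (if v \<in> pure then 1
     else if decompositions v = {} then (if tangent v then 3 else 5)
     else (if card (decompositions v) = 2 then 4 else 2))"

lemma tangent_mono:
  assumes f: "f \<in> segre_auts" and "tangent v"
  shows "tangent (f v)"
proof -
  interpret f: Vector_Spaces.linear "(*s)" "(*s)" f using f by (simp add: segre_auts_def GL_def)
  obtain x y1 y2 y3 where *: "{x, y1, y2, y3, x + y1, x + y2, x + y3} \<subseteq> pure" "v = y1 + y2 + y3"
    using assms(2) by (auto simp: tangent_def)
  have im: "z \<in> pure \<Longrightarrow> f z \<in> pure" for z using f by (auto simp: segre_auts_def)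
  have "{f x, f y1, f y2, f y3, f x + f y1, f x + f y2, f x + f y3} \<subseteq> pure"
    using * im by (simp add: f.add[symmetric])
  moreover have "f v = f y1 + f y2 + f y3" using * by (simp add: f.add)
  ultimately show ?thesis unfolding tangent_def by blast
qed

lemma orbit_type_equivalent:
  assumes "v \<simeq> w"
  shows "orbit_type v = orbit_type w"
proof -
  obtain f where f: "f \<in> segre_auts" "w = f v" using assms by (auto simp: equivalent_def)
  interpret f: Vector_Spaces.linear "(*s)" "(*s)" f using f by (simp add: segre_auts_def GL_def)
  have inj: "inj f" using f by (simp add: segre_auts_def GL_def bij_is_inj)
  have im: "f ` pure = pure" using f by (simp add: segre_auts_def)
  then have pure: "f z \<in> pure \<longleftrightarrow> z \<in> pure" for z using inj by (metis inj_image_mem_iff)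
  have "decompositions (f v) = f ` decompositions v"
  proof (intro subset_antisym subsetI)
    fix y assume y: "y \<in> decompositions (f v)"
    then obtain x where x: "x \<in> pure" "y = f x" using im by (auto simp: decompositions_def)
    then have "v - x \<in> pure" using y pure[of "v - x"] by (simp add: decompositions_def f.diff)
    then show "y \<in> f ` decompositions v" using x by (simp add: decompositions_def)
  next
    fix y assume "y \<in> f ` decompositions v"
    then obtain x where "x \<in> pure" "v - x \<in> pure" "y = f x" by (auto simp: decompositions_def)
    then show "y \<in> decompositions (f v)" using pure[of "v - x"] pure[of x]
      by (simp add: decompositions_def f.diff)
  qed
  moreover have "card (f ` decompositions v) = card (decompositions v)"
    using inj by (metis card_image inj_on_subset subset_UNIV)
  moreover have "tangent (f v) \<longleftrightarrow> tangent v"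
  proof
    assume "tangent (f v)"
    then show "tangent v"
      using tangent_mono[OF segre_auts_inv[OF f(1)], of "f v"] inj by simp
  qed (rule tangent_mono[OF f(1)])
  ultimately show ?thesis using pure[of v] by (simp add: orbit_type_def f(2))
qed

text \<open>
  These are 2 by 2 minors of the three flattenings of the tensor, each of which has rank one for a
  pure tensor.
\<close>

lemma pure_minors:
  assumes "tens a b c d e f g h \<in> pure"
  shows "a * d = b * c" "a * f = b * e" "a * g = c * e"
    "e * h = f * g" "c * h = d * g" "b * h = d * f"
    "a * h = b * g" "a * h = c * f" "a * h = d * e"
proof -
  obtain u v w where "tens a b c d e f g h = tensor3 u v w" using assms by (auto simp: pure_def)
  then show "a * d = b * c" "a * f = b * e" "a * g = c * e"
    "e * h = f * g" "c * h = d * g" "b * h = d * f"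
    "a * h = b * g" "a * h = c * f" "a * h = d * e"
    by (simp_all add: tensor3_eq_tens tens_eq_iff)
qed

lemma tensor3_pure: "u \<noteq> 0 \<Longrightarrow> v \<noteq> 0 \<Longrightarrow> w \<noteq> 0 \<Longrightarrow> tensor3 u v w \<in> pure"
  unfolding pure_def by blast

definition annihilator :: "'a::field ^ 2 \<Rightarrow> 'a ^ 2" where
  "annihilator u = vector [- u $ 2, u $ 1]"

lemma annihilator_eq_0_iff: "annihilator u = 0 \<longleftrightarrow> u = 0"
  by (auto simp: annihilator_def vec2_eq_0_iff)

lemma contract_add: "contract \<phi> \<psi> (x + y) k = contract \<phi> \<psi> x k + contract \<phi> \<psi> y k"
  by (simp add: contract_def sum.distrib algebra_simps)

lemma contract_annihilators_tensor3:
  "contract (annihilator u) (annihilator v) (tensor3 u' v' w') k =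
    (u $ 1 * u' $ 2 - u $ 2 * u' $ 1) * (v $ 1 * v' $ 2 - v $ 2 * v' $ 1) * w' $ k"
  by (simp add: contract_def annihilator_def tensor3_def sum_2 algebra_simps)

lemma degenerateI:
  assumes "u \<noteq> 0" "v \<noteq> 0" "\<And>k. contract (annihilator u) (annihilator v) x k = 0"
  shows "degenerate x"
  using assms annihilator_eq_0_iff unfolding degenerate_def by blast

lemma degenerate_pure:
  assumes "x \<in> pure"
  shows "degenerate x"
proof -
  obtain u v w where x: "x = tensor3 u v w" "u \<noteq> 0" "v \<noteq> 0" using assms by (auto simp: pure_def)
  show ?thesis
    by (rule degenerateI[OF x(2,3)]) (simp add: x(1) contract_annihilators_tensor3 mult.commute)
qed

text \<open>
  A functional that kills the first summand in the first factor and one that kills the second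
  summand in the second factor together kill the sum.
\<close>

lemma degenerate_pure_add:
  assumes "x \<in> pure" "y \<in> pure"
  shows "degenerate (x + y)"
proof -
  obtain u v w where x: "x = tensor3 u v w" "u \<noteq> 0" using assms(1) by (auto simp: pure_def)
  obtain u' v' w' where y: "y = tensor3 u' v' w'" "v' \<noteq> 0" using assms(2) by (auto simp: pure_def)
  show ?thesis
    by (rule degenerateI[OF x(2) y(2)])
      (simp add: x(1) y(1) contract_add contract_annihilators_tensor3 mult.commute)
qed

text \<open>
  Collinear points of the Segre variety differ in at most one factor, hence agree in the first
  or the second. The determinant of the pencil of slices of the sum is, up to the constant \<open>A\<close>
  that measures disagreement in both factors, the product of the linear forms \<open>w\<close> and
  \<open>w'\<close>. For a pure sum it vanishes identically, which forces \<open>A = 0\<close>.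
\<close>

lemma contract_collinear:
  assumes "w \<noteq> 0" "w' \<noteq> 0" and pure: "tensor3 u v w + tensor3 u' v' w' \<in> pure"
  shows "contract (annihilator u) (annihilator v) (tensor3 u' v' w') k = 0"
proof -
  define A where "A = (u $ 1 * u' $ 2 - u $ 2 * u' $ 1) * (v $ 1 * v' $ 2 - v $ 2 * v' $ 1)"
  note minors = pure_minors[OF pure[unfolded tensor3_eq_tens tens_add]]
  have 1: "A * (w $ 1 * w' $ 1) = 0" using minors(3) unfolding A_def by algebra
  have 2: "A * (w $ 2 * w' $ 2) = 0" using minors(6) unfolding A_def by algebra
  have 3: "A * (w $ 1 * w' $ 2 + w $ 2 * w' $ 1) = 0" using minors(7,8,9) unfolding A_def by algebra
  have "A = 0" using 1 2 3 assms(1,2) by (auto simp: vec2_eq_0_iff)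
  then show ?thesis by (simp add: contract_annihilators_tensor3 A_def)
qed

lemma tangent_imp_degenerate:
  assumes "tangent t"
  shows "degenerate t"
proof -
  obtain x y1 y2 y3 where *: "x \<in> pure" "y1 \<in> pure" "y2 \<in> pure" "y3 \<in> pure"
      "x + y1 \<in> pure" "x + y2 \<in> pure" "x + y3 \<in> pure" "t = y1 + y2 + y3"
    using assms by (auto simp: tangent_def)
  obtain u v w where x: "x = tensor3 u v w" "u \<noteq> 0" "v \<noteq> 0" "w \<noteq> 0"
    using *(1) by (auto simp: pure_def)
  have "contract (annihilator u) (annihilator v) y k = 0" if "y \<in> pure" "x + y \<in> pure" for y k
  proof -
    obtain u' v' w' where "y = tensor3 u' v' w'" "w' \<noteq> 0" using \<open>y \<in> pure\<close> by (auto simp: pure_def)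
    then show ?thesis using contract_collinear[OF x(4)] that(2) unfolding x(1) by blast
  qed
  then show ?thesis using * by (intro degenerateI[OF x(2,3)]) (simp add: contract_add)
qed

lemma orbit_type_nondegenerate:
  assumes "\<not> degenerate v"
  shows "orbit_type v = 5"
proof -
  have "v \<notin> pure" "\<not> tangent v" using assms degenerate_pure tangent_imp_degenerate by blast+
  moreover have "decompositions v = {}"
  proof (rule ccontr)
    assume "decompositions v \<noteq> {}"
    then obtain x where "x \<in> pure" "v - x \<in> pure" by (auto simp: decompositions_def)
    then show False using degenerate_pure_add[of x "v - x"] assms by simp
  qed
  ultimately show ?thesis by (simp add: orbit_type_def)
qed

lemma vector2_nonzero: "vector [p, q] \<noteq> (0 :: 'a::field ^ 2) \<longleftrightarrow> p \<noteq> 0 \<or> q \<noteq> 0"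
  by (simp add: vec2_eq_0_iff)

lemma tens_pureI:
  assumes "p \<noteq> 0 \<or> q \<noteq> 0" "p' \<noteq> 0 \<or> q' \<noteq> 0" "p'' \<noteq> 0 \<or> q'' \<noteq> 0"
    and "a = p * p' * p''" "b = p * p' * q''" "c = p * q' * p''" "d = p * q' * q''"
    and "e = q * p' * p''" "f = q * p' * q''" "g = q * q' * p''" "h = q * q' * q''"
  shows "tens a b c d e f g h \<in> pure"
proof -
  have "tens a b c d e f g h = tensor3 (vector [p, q]) (vector [p', q']) (vector [p'', q''])"
    using assms by (simp add: tensor3_eq_tens)
  then show ?thesis using assms by (simp add: tensor3_pure vector2_nonzero)
qed

lemma orbit_type_decomposable_form: "orbit_type decomposable_form = 1"
proof -
  have "decomposable_form \<in> pure" by (rule tens_pureI[of 1 0 1 0 1 0]) auto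
  then show ?thesis by (simp add: orbit_type_def)
qed

text \<open>
  Besides the obvious decomposition of the identity matrix into two matrices of rank one there is
  the one into \<open>(1, 0; 1, 0)\<close> and \<open>(0, 0; -1, 1)\<close>, over every field.
\<close>

lemma orbit_type_slab_form: "orbit_type (slab_form :: 'a::field tensor222) = 2"
proof -
  let ?x = "tens 1 0 0 0 0 0 0 0 :: 'a tensor222" and ?y = "tens 0 0 0 1 0 0 0 0 :: 'a tensor222"
  let ?z = "tens 1 0 1 0 0 0 0 0 :: 'a tensor222"
  have 1: "?x \<in> pure" by (rule tens_pureI[of 1 0 1 0 1 0]) auto
  have 2: "?y \<in> pure" by (rule tens_pureI[of 1 0 0 1 0 1]) auto
  have 3: "?z \<in> pure" by (rule tens_pureI[of 1 0 1 1 1 0]) auto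
  have 4: "tens 0 0 (- 1) 1 0 0 0 0 \<in> (pure :: 'a tensor222 set)"
    by (rule tens_pureI[of 1 0 0 1 "- 1" 1]) auto
  have sub: "{?x, ?y, ?z} \<subseteq> decompositions slab_form"
    using 1 2 3 4 by (auto simp: decompositions_def tens_diff)
  have three: "card {?x, ?y, ?z} = 3" by (simp add: tens_eq_iff)
  have "card (decompositions (slab_form :: 'a tensor222)) \<noteq> 2"
  proof
    assume card: "card (decompositions (slab_form :: 'a tensor222)) = 2"
    then have "finite (decompositions (slab_form :: 'a tensor222))" by (metis card.infinite zero_neq_numeral)
    then show False using card_mono[OF _ sub] card three by simp
  qed
  moreover have "slab_form \<notin> (pure :: 'a tensor222 set)" using pure_minors(1) by fastforce
  ultimately show ?thesis using sub by (auto simp: orbit_type_def)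
qed

text \<open>
  Comparing each minor of a summand \<open>x\<close> with the same minor of \<open>secant_form - x\<close> makes all
  entries of \<open>x\<close> vanish except the two extreme ones, which are then complementary idempotents.
\<close>

lemma orbit_type_secant_form: "orbit_type (secant_form :: 'a::field tensor222) = 4"
proof -
  let ?x = "tens 1 0 0 0 0 0 0 0 :: 'a tensor222" and ?y = "tens 0 0 0 0 0 0 0 1 :: 'a tensor222"
  have 1: "?x \<in> pure" by (rule tens_pureI[of 1 0 1 0 1 0]) auto
  have 2: "?y \<in> pure" by (rule tens_pureI[of 0 1 0 1 0 1]) auto
  have "decompositions secant_form = {?x, ?y}"
  proof (intro subset_antisym subsetI)
    fix x :: "'a tensor222" assume x: "x \<in> decompositions secant_form"
    obtain a b c d e f g h where xt: "x = tens a b c d e f g h" by (rule tens_cases)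
    have "tens a b c d e f g h \<in> pure" "tens (1 - a) (- b) (- c) (- d) (- e) (- f) (- g) (1 - h) \<in> pure"
      using x by (simp_all add: decompositions_def xt tens_diff)
    note m = pure_minors[OF this(1)] and n = pure_minors[OF this(2)]
    have 0: "b = 0" "c = 0" "d = 0" "e = 0" "f = 0" "g = 0" using m n by algebra+
    have "a * h = 0" "a + h = 1" using m(7) n(7) 0 by algebra+
    then show "x \<in> {?x, ?y}" using 0 by (auto simp: xt)
  qed (use 1 2 in \<open>auto simp: decompositions_def tens_diff\<close>)
  moreover have "secant_form \<notin> (pure :: 'a tensor222 set)" using pure_minors(7) by fastforce
  moreover have "card {?x, ?y} = 2" by (simp add: tens_eq_iff)
  ultimately show ?thesis by (simp add: orbit_type_def)
qed

text \<open>
  Here the comparison of minors leaves three entries \<open>b, c, e\<close> with pairwise products 0 and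
  pairwise sums 1, which is impossible.
\<close>

lemma orbit_type_tangent_form: "orbit_type (tangent_form :: 'a::field tensor222) = 3"
proof -
  have "decompositions (tangent_form :: 'a tensor222) = {}"
  proof (rule ccontr)
    assume "decompositions (tangent_form :: 'a tensor222) \<noteq> {}"
    then obtain x :: "'a tensor222" where x: "x \<in> decompositions tangent_form" by blast
    obtain a b c d e f g h where xt: "x = tens a b c d e f g h" by (rule tens_cases)
    have "tens a b c d e f g h \<in> pure" "tens (- a) (1 - b) (1 - c) (- d) (1 - e) (- f) (- g) (- h) \<in> pure"
      using x by (simp_all add: decompositions_def xt tens_diff)
    note m = pure_minors[OF this(1)] and n = pure_minors[OF this(2)]
    have s: "b + c = 1" "b + e = 1" "c + e = 1" using m(1-3) n(1-3) by algebra+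
    have 0: "g = 0" "f = 0" "d = 0" using m(7-9) n(7-9) by algebra+
    have "b * c = 0" "b * e = 0" "c * e = 0" using m(1-3) 0 by auto
    then show False using s by auto
  qed
  moreover have "tangent_form \<notin> (pure :: 'a tensor222 set)" using pure_minors(1) by fastforce
  moreover have "tangent (tangent_form :: 'a tensor222)"
  proof -
    let ?x = "tens 1 0 0 0 0 0 0 0 :: 'a tensor222"
    let ?y1 = "tens 0 1 0 0 0 0 0 0 :: 'a tensor222"
    let ?y2 = "tens 0 0 1 0 0 0 0 0 :: 'a tensor222"
    let ?y3 = "tens 0 0 0 0 1 0 0 0 :: 'a tensor222"
    have 0: "?x \<in> pure" by (rule tens_pureI[of 1 0 1 0 1 0]) auto
    have 1: "?y1 \<in> pure" by (rule tens_pureI[of 1 0 1 0 0 1]) auto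
    have 2: "?y2 \<in> pure" by (rule tens_pureI[of 1 0 0 1 1 0]) auto
    have 3: "?y3 \<in> pure" by (rule tens_pureI[of 0 1 1 0 1 0]) auto
    have 4: "?x + ?y1 \<in> pure" unfolding tens_add by (rule tens_pureI[of 1 0 1 0 1 1]) auto
    have 5: "?x + ?y2 \<in> pure" unfolding tens_add by (rule tens_pureI[of 1 0 1 1 1 0]) auto
    have 6: "?x + ?y3 \<in> pure" unfolding tens_add by (rule tens_pureI[of 1 1 1 0 1 0]) auto
    have "{?x, ?y1, ?y2, ?y3, ?x + ?y1, ?x + ?y2, ?x + ?y3} \<subseteq> pure" using 0 1 2 3 4 5 6 by blast
    moreover have "tangent_form = ?y1 + ?y2 + ?y3" by (simp add: tens_add)
    ultimately show ?thesis unfolding tangent_def by blast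
  qed
  ultimately show ?thesis by (simp add: orbit_type_def)
qed

lemmas orbit_type_degenerate_forms =
  orbit_type_decomposable_form orbit_type_slab_form orbit_type_tangent_form orbit_type_secant_form

lemma card_degenerate_forms: "card degenerate_forms = 4"
  by (simp add: degenerate_forms_def tens_eq_iff)

section \<open>Quadratic extensions of finite fields\<close>

text \<open>
  The tables for the bases \<open>1, \<theta>\<close> and \<open>1, a + b\<theta>\<close> describe the same multiplication, and the
  new coefficients come from \<open>(a + b\<theta>)\<^sup>2\<close>.
\<close>

lemma field_form_change_generator:
  assumes "b \<noteq> 0"
  shows "field_form \<alpha> \<beta> \<simeq> field_form (b\<^sup>2 * \<alpha> - a\<^sup>2 - a * b * \<beta>) (2 * a + b * \<beta>)"
proof -
  have "field_form \<alpha> \<beta> \<simeq> tens 1 0 0 1 a b (b * \<alpha>) (a + b * \<beta>)"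
    using equivalent_factor1[of 1 b 0 a 1 0 0 1 0 1 \<alpha> \<beta>] assms by simp
  also have "\<dots> \<simeq> tens 1 0 a b a b (a * a + b * (b * \<alpha>)) (a * b + b * (a + b * \<beta>))"
    using equivalent_factor2[of 1 b 0 a 1 0 0 1 a b "b * \<alpha>" "a + b * \<beta>"] assms by simp
  also have "\<dots> \<simeq> field_form (b\<^sup>2 * \<alpha> - a\<^sup>2 - a * b * \<beta>) (2 * a + b * \<beta>)"
  proof -
    have e: "a * a + b * (b * \<alpha>) - a * (a * b + b * (a + b * \<beta>)) / b = b\<^sup>2 * \<alpha> - a\<^sup>2 - a * b * \<beta>"
      "(a * b + b * (a + b * \<beta>)) / b = 2 * a + b * \<beta>"
      using assms by (simp_all add: field_simps power2_eq_square)
    show ?thesis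
      using equivalent_factor3[of 1 "1 / b" "- a / b" 0 1 0 a b a b "a * a + b * (b * \<alpha>)"
          "a * b + b * (a + b * \<beta>)"] assms e by simp
  qed
  finally show ?thesis .
qed

text \<open>
  The image of an at most two-to-one map fills at least half of a finite set. So it and a disjoint
  translate of it leave nothing over. This single count serves for squares in odd characteristic
  and for the additive map \<open>x \<mapsto> x\<^sup>2 + \<beta> x\<close> in characteristic 2.
\<close>

lemma two_to_one_images_cover:
  assumes fin: "finite G" and h: "h ` G \<subseteq> G"
    and fib: "\<And>x. x \<in> G \<Longrightarrow> card {y \<in> G. h y = h x} \<le> 2"
    and \<sigma>: "inj_on \<sigma> G" "\<sigma> ` h ` G \<subseteq> G" "\<sigma> ` h ` G \<inter> h ` G = {}"
    and z: "z \<in> G" "z \<notin> h ` G"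
  shows "z \<in> \<sigma> ` h ` G"
proof -
  have "card G = (\<Sum>y\<in>h ` G. card {x \<in> G. h x = y})"
    using sum.image_gen[OF fin, of "\<lambda>_. 1::nat" h] by simp
  also have "\<dots> \<le> (\<Sum>y\<in>h ` G. 2)" using fib by (intro sum_mono) auto
  finally have "card G \<le> card (h ` G) + card (\<sigma> ` h ` G)"
    using card_image[OF inj_on_subset[OF \<sigma>(1) h]] by simp
  also have "\<dots> = card (h ` G \<union> \<sigma> ` h ` G)"
    using fin \<sigma>(3) by (subst card_Un_disjoint) auto
  finally have "h ` G \<union> \<sigma> ` h ` G = G"
    using fin h \<sigma>(2) by (intro card_seteq) auto
  then show ?thesis using z by blast
qed

lemma nonsquare_quotient_square:
  fixes D D' :: "'a::field"
  assumes fin: "finite (UNIV :: 'a set)"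
    and D: "\<nexists>x. x\<^sup>2 = D" and D': "\<nexists>x. x\<^sup>2 = D'"
  shows "\<exists>b. b \<noteq> 0 \<and> D' = b\<^sup>2 * D"
proof -
  let ?G = "UNIV - {0 :: 'a}"
  have D0: "D \<noteq> 0" using D by (metis zero_power2)
  have "D' \<in> (\<lambda>x. D * x) ` (\<lambda>x. x\<^sup>2) ` ?G"
  proof (rule two_to_one_images_cover)
    show "card {y \<in> ?G. y\<^sup>2 = x\<^sup>2} \<le> 2" for x :: 'a
    proof -
      have "{y \<in> ?G. y\<^sup>2 = x\<^sup>2} \<subseteq> {x, - x}" by (auto simp: power2_eq_iff)
      then have "card {y \<in> ?G. y\<^sup>2 = x\<^sup>2} \<le> card {x, - x}" by (intro card_mono) auto
      also have "\<dots> \<le> 2" by (simp add: card_insert_if)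
      finally show ?thesis .
    qed
    show "(\<lambda>x. D * x) ` (\<lambda>x. x\<^sup>2) ` ?G \<inter> (\<lambda>x. x\<^sup>2) ` ?G = {}"
    proof -
      have "D * x\<^sup>2 \<noteq> y\<^sup>2" if "x \<noteq> 0" for x y :: 'a
      proof
        assume "D * x\<^sup>2 = y\<^sup>2"
        then have "(y / x)\<^sup>2 = D" using that by (simp add: power_divide field_simps)
        then show False using D by blast
      qed
      then show ?thesis by auto
    qed
    show "D' \<in> ?G" using D' by auto
    show "D' \<notin> (\<lambda>x. x\<^sup>2) ` ?G" using D' by auto
  qed (use fin D0 in \<open>auto simp: inj_on_def finite_subset\<close>)
  then show ?thesis by (auto simp: mult.commute)
qed

lemma artin_schreier_difference:
  fixes \<beta> \<alpha> \<alpha>' :: "'a::field"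
  assumes fin: "finite (UNIV :: 'a set)" and two: "(2 :: 'a) = 0"
    and \<alpha>: "\<nexists>x. x\<^sup>2 + \<beta> * x = \<alpha>" and \<alpha>': "\<nexists>x. x\<^sup>2 + \<beta> * x = \<alpha>'"
  shows "\<exists>a. a\<^sup>2 + \<beta> * a = \<alpha> - \<alpha>'"
proof -
  let ?h = "\<lambda>x. x\<^sup>2 + \<beta> * x"
  have "\<alpha> \<in> (\<lambda>x. \<alpha>' + x) ` ?h ` UNIV"
  proof (rule two_to_one_images_cover)
    show "card {y \<in> UNIV. ?h y = ?h x} \<le> 2" for x :: 'a
    proof -
      have "y = x \<or> y = - x - \<beta>" if "?h y = ?h x" for y
      proof -
        have "(y - x) * (y + x + \<beta>) = 0" using that by algebra
        then consider "y - x = 0" | "y + x + \<beta> = 0" by auto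
        then show ?thesis by cases algebra+
      qed
      then have "{y \<in> UNIV. ?h y = ?h x} \<subseteq> {x, - x - \<beta>}" by auto
      then have "card {y \<in> UNIV. ?h y = ?h x} \<le> card {x, - x - \<beta>}" by (intro card_mono) auto
      also have "\<dots> \<le> 2" by (simp add: card_insert_if)
      finally show ?thesis .
    qed
    show "(\<lambda>x. \<alpha>' + x) ` ?h ` UNIV \<inter> ?h ` UNIV = {}"
    proof -
      have "\<alpha>' + ?h x \<noteq> ?h y" for x y
      proof
        assume eq: "\<alpha>' + ?h x = ?h y"
        have "?h (y - x) = ?h y - ?h x + 2 * (x\<^sup>2 - x * y)"
          by (simp add: algebra_simps power2_eq_square)
        also have "\<dots> = \<alpha>'" unfolding eq[symmetric] two by simp
        finally have "?h (y - x) = \<alpha>'" .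
        then show False using \<alpha>' by blast
      qed
      then show ?thesis by auto
    qed
    show "\<alpha> \<notin> ?h ` UNIV" using \<alpha> by auto
  qed (use fin in auto)
  then show ?thesis by (auto simp: algebra_simps)
qed

text \<open>
  Both fields have the same number of elements and are thus isomorphic, and an isomorphism sends
  a generator to some \<open>a + b\<theta>\<close>. The coefficients \<open>a, b\<close> are found directly. In odd
  characteristic the discriminants are nonsquares and differ by a square \<open>b\<^sup>2\<close>, and \<open>a\<close>
  completes the square. In characteristic 2 the linear coefficients are nonzero, since otherwise
  a square root would be a root; they determine \<open>b\<close>, and \<open>a\<close> solves an Artin-Schreier type
  equation.
\<close>

lemma field_forms_equivalent:
  fixes \<alpha> \<beta> \<alpha>' \<beta>' :: "'a::field"
  assumes fin: "finite (UNIV :: 'a set)"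
    and irr: "\<nexists>x. x\<^sup>2 = \<beta> * x + \<alpha>" and irr': "\<nexists>x. x\<^sup>2 = \<beta>' * x + \<alpha>'"
  shows "field_form \<alpha> \<beta> \<simeq> field_form \<alpha>' \<beta>'"
proof -
  have "\<exists>a b. b \<noteq> 0 \<and> \<beta>' = 2 * a + b * \<beta> \<and> \<alpha>' = b\<^sup>2 * \<alpha> - a\<^sup>2 - a * b * \<beta>"
  proof (cases "(2 :: 'a) = 0")
    case False
    have disc: "\<nexists>x. x\<^sup>2 = s\<^sup>2 + 4 * t" if "\<nexists>x. x\<^sup>2 = s * x + t" for s t :: 'a
    proof
      assume "\<exists>x. x\<^sup>2 = s\<^sup>2 + 4 * t"
      then obtain x where x: "x\<^sup>2 = s\<^sup>2 + 4 * t" by blast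
      define y where "y = (x + s) / 2"
      have "2 * y = x + s"
        unfolding y_def using False by (metis nonzero_mult_div_cancel_left times_divide_eq_right)
      then have "x = 2 * y - s" by algebra
      then have "4 * (y\<^sup>2 - s * y - t) = 0" using x by algebra
      moreover have "(4 :: 'a) \<noteq> 0" using False by (metis mult_2 mult_eq_0_iff numeral_Bit0 one_add_one)
      ultimately have "y\<^sup>2 - s * y - t = 0" by (metis mult_eq_0_iff)
      then have "y\<^sup>2 = s * y + t" by algebra
      then show False using that by blast
    qed
    obtain b where b: "b \<noteq> 0" "\<beta>'\<^sup>2 + 4 * \<alpha>' = b\<^sup>2 * (\<beta>\<^sup>2 + 4 * \<alpha>)"
      using nonsquare_quotient_square[OF fin disc[OF irr] disc[OF irr']] by blast
    define a where "a = (\<beta>' - b * \<beta>) / 2"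
    have "2 * a = \<beta>' - b * \<beta>"
      unfolding a_def using False by (metis nonzero_mult_div_cancel_left times_divide_eq_right)
    then have a: "\<beta>' = 2 * a + b * \<beta>" by algebra
    then have "4 * (\<alpha>' - (b\<^sup>2 * \<alpha> - a\<^sup>2 - a * b * \<beta>)) = 0" using b(2) by algebra
    moreover have "(4 :: 'a) \<noteq> 0" using False by (metis mult_2 mult_eq_0_iff numeral_Bit0 one_add_one)
    ultimately have "\<alpha>' - (b\<^sup>2 * \<alpha> - a\<^sup>2 - a * b * \<beta>) = 0" by (metis mult_eq_0_iff)
    then have "\<alpha>' = b\<^sup>2 * \<alpha> - a\<^sup>2 - a * b * \<beta>" by algebra
    with a b(1) show ?thesis by blast
  next
    case two: True
    have nonzero: "s \<noteq> 0" if "\<nexists>x. x\<^sup>2 = s * x + t" for s t :: 'a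
    proof
      assume "s = 0"
      have "inj (\<lambda>x :: 'a. x\<^sup>2)"
      proof (rule injI)
        fix x y :: 'a assume "x\<^sup>2 = y\<^sup>2"
        moreover have "(x - y)\<^sup>2 = (x\<^sup>2 - y\<^sup>2) + 2 * (y\<^sup>2 - x * y)" by algebra
        ultimately have "(x - y)\<^sup>2 = 0" using two by simp
        then show "x = y" by simp
      qed
      then have "surj (\<lambda>x :: 'a. x\<^sup>2)" by (rule finite_UNIV_inj_surj[OF fin])
      then obtain x where "x\<^sup>2 = t" by (metis surjD)
      then show False using that \<open>s = 0\<close> by simp
    qed
    define b where "b = \<beta>' / \<beta>"
    have b: "b \<noteq> 0" "\<beta>' = b * \<beta>" using nonzero[OF irr] nonzero[OF irr'] by (simp_all add: b_def)
    have 1: "\<nexists>x. x\<^sup>2 + \<beta>' * x = \<alpha>'"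
    proof
      assume "\<exists>x. x\<^sup>2 + \<beta>' * x = \<alpha>'"
      then obtain x where "x\<^sup>2 + \<beta>' * x = \<alpha>'" by blast
      then have "x\<^sup>2 = \<alpha>' + \<beta>' * x - 2 * (\<beta>' * x)" by (auto simp: algebra_simps)
      then have "x\<^sup>2 = \<beta>' * x + \<alpha>'" unfolding two by simp
      then show False using irr' by blast
    qed
    have 2: "\<nexists>x. x\<^sup>2 + \<beta>' * x = b\<^sup>2 * \<alpha>"
    proof
      assume "\<exists>x. x\<^sup>2 + \<beta>' * x = b\<^sup>2 * \<alpha>"
      then obtain x where x: "x\<^sup>2 + \<beta>' * x = b\<^sup>2 * \<alpha>" by blast
      define y where "y = x / b"
      have "x = b * y" using b by (simp add: y_def)
      then have "b\<^sup>2 * (y\<^sup>2 - \<beta> * y - \<alpha>) = - 2 * (b\<^sup>2 * \<beta> * y)" using x b(2) by algebra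
      then have "b\<^sup>2 * (y\<^sup>2 - \<beta> * y - \<alpha>) = 0" using two by simp
      then have "y\<^sup>2 - \<beta> * y - \<alpha> = 0" using b(1) by (metis mult_eq_0_iff zero_eq_power2)
      then have "y\<^sup>2 = \<beta> * y + \<alpha>" by algebra
      then show False using irr by blast
    qed
    obtain a where a: "a\<^sup>2 + \<beta>' * a = b\<^sup>2 * \<alpha> - \<alpha>'"
      using artin_schreier_difference[OF fin two 2 1] by blast
    have "\<alpha>' = b\<^sup>2 * \<alpha> - a\<^sup>2 - a * b * \<beta>" using a b(2) by algebra
    moreover have "\<beta>' = 2 * a + b * \<beta>" using two b(2) by simp
    ultimately show ?thesis using b(1) by blast
  qed
  then show ?thesis using field_form_change_generator by metis
qed

text \<open>
  The map \<open>x \<mapsto> x\<^sup>2 - x\<close> takes the same value at 0 and 1, so on a finite field it misses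
  some value; this argument does not depend on the characteristic.
\<close>

lemma irreducible_quadratic_exists:
  assumes fin: "finite (UNIV :: 'a::field set)"
  shows "\<exists>\<alpha> :: 'a. \<nexists>x. x\<^sup>2 = 1 * x + \<alpha>"
proof (rule ccontr)
  assume "\<not> ?thesis"
  then have "surj (\<lambda>x :: 'a. x\<^sup>2 - x)" unfolding surj_def by (metis add_diff_cancel_left' mult_1)
  then have "inj (\<lambda>x :: 'a. x\<^sup>2 - x)" by (rule finite_UNIV_surj_inj[OF fin])
  then show False by (auto dest: injD[of _ 0 1])
qed

text \<open>
  Both parts of the theorem are instances: \<open>N\<close> is empty over an algebraically closed field and a
  singleton over a finite field. The set \<open>N\<close> may have at most one element, since
  \<open>orbit_type\<close> does not distinguish field forms from each other.
\<close>

lemma card_orbits_if_nondegenerate_transversal: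
  fixes N :: "'a::field tensor222 set"
  assumes "\<And>\<alpha> \<beta> :: 'a. \<nexists>x. x\<^sup>2 = \<beta> * x + \<alpha> \<Longrightarrow> \<exists>n\<in>N. field_form \<alpha> \<beta> \<simeq> n"
    and "\<And>n. n \<in> N \<Longrightarrow> \<not> degenerate n" and "\<And>m n. m \<in> N \<Longrightarrow> n \<in> N \<Longrightarrow> m = n"
    and "finite N"
  shows "card (orbits (segre_stabilizer :: ('a tensor222 \<Rightarrow> 'a tensor222) set monoid) PG PGL_act) = 4 + card N"
proof -
  have N5: "orbit_type n = 5" if "n \<in> N" for n using assms(2) orbit_type_nondegenerate that by blast
  have inj: "inj_on orbit_type (degenerate_forms \<union> N)"
    unfolding inj_on_def degenerate_forms_def
    using assms(3) by (auto simp: orbit_type_degenerate_forms N5)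
  have "card (orbits (segre_stabilizer :: ('a tensor222 \<Rightarrow> 'a tensor222) set monoid) PG PGL_act) =
      card (degenerate_forms \<union> N)"
  proof (rule card_orbits_transversal)
    show "\<exists>n\<in>degenerate_forms \<union> N. v \<simeq> n" if "v \<noteq> 0" for v
      using classification[OF that] assms(1) equivalent_trans by blast
    show "m = n" if "m \<in> degenerate_forms \<union> N" "n \<in> degenerate_forms \<union> N" "m \<simeq> n" for m n
      using inj that orbit_type_equivalent by (auto dest: inj_onD)
    have "degenerate (0 :: 'a tensor222)" 
      by (rule degenerateI[of "vector [1, 0]" "vector [1, 0]"]) (simp_all add: vector2_nonzero contract_def)
    then show "0 \<notin> degenerate_forms \<union> N"
      using assms(2) by (auto simp: degenerate_forms_def tens_eq_0_iff dest: sym)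
  qed
  also have "\<dots> = card (degenerate_forms :: 'a tensor222 set) + card N"
  proof (rule card_Un_disjoint)
    show "degenerate_forms \<inter> N = {}"
      using N5 by (auto simp: degenerate_forms_def) (fastforce simp: orbit_type_degenerate_forms)+
  qed (use assms(4) in \<open>simp_all add: degenerate_forms_def\<close>)
  finally show ?thesis by (simp add: card_degenerate_forms)
qed

theorem theorem3p5:
  shows "((\<forall>p :: 'a::field poly. degree p > 0 \<longrightarrow> (\<exists>x. poly p x = 0)) \<longrightarrow>
            card (orbits (segre_stabilizer :: ('a tensor222 \<Rightarrow> 'a tensor222) set monoid) PG PGL_act) = 4) \<and>
         (finite (UNIV :: 'a set) \<longrightarrow>
            card (orbits (segre_stabilizer :: ('a tensor222 \<Rightarrow> 'a tensor222) set monoid) PG PGL_act) = 5)"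
proof (intro conjI impI)
  assume closed: "\<forall>p :: 'a poly. degree p > 0 \<longrightarrow> (\<exists>x. poly p x = 0)"
  have "\<exists>x. x\<^sup>2 = \<beta> * x + \<alpha>" for \<alpha> \<beta> :: 'a
  proof -
    obtain x where "poly [:- \<alpha>, - \<beta>, 1:] x = 0" using closed[rule_format, of "[:- \<alpha>, - \<beta>, 1:]"] by auto
    then have "x\<^sup>2 = \<beta> * x + \<alpha>" by (simp add: algebra_simps power2_eq_square)
    then show ?thesis by blast
  qed
  then show "card (orbits (segre_stabilizer :: ('a tensor222 \<Rightarrow> 'a tensor222) set monoid) PG PGL_act) = 4"
    using card_orbits_if_nondegenerate_transversal[of "{} :: 'a tensor222 set"] by simp
next
  assume fin: "finite (UNIV :: 'a set)"
  obtain \<alpha> :: 'a where \<alpha>: "\<nexists>x. x\<^sup>2 = 1 * x + \<alpha>" using irreducible_quadratic_exists[OF fin] by blast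
  have "card (orbits (segre_stabilizer :: ('a tensor222 \<Rightarrow> 'a tensor222) set monoid) PG PGL_act) =
      4 + card {field_form \<alpha> 1}"
  proof (rule card_orbits_if_nondegenerate_transversal)
    show "\<exists>n\<in>{field_form \<alpha> 1}. field_form \<alpha>' \<beta>' \<simeq> n" if "\<nexists>x. x\<^sup>2 = \<beta>' * x + \<alpha>'" for \<alpha>' \<beta>' :: 'a
      using field_forms_equivalent[OF fin that \<alpha>] by blast
    show "\<not> degenerate n" if "n \<in> {field_form \<alpha> 1}" for n
      using that \<alpha> field_form_degenerate_iff[of \<alpha> 1] by blast
  qed auto
  then show "card (orbits (segre_stabilizer :: ('a tensor222 \<Rightarrow> 'a tensor222) set monoid) PG PGL_act) = 5"
    by simp
qed

end
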